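(* There exists $\alpha_0\in(0,1)$ such that for all $\alpha\in(0,\alpha_0)$ the following holds. For every finite label set $\Xi$, every injective $X:\Xi\to\mathbb{R}^2$ with $\min_{p\ne q\in\Xi}|X(p)-X(q)|>1-\alpha$, and every $p\in\Xi$ with $\mathcal N_\alpha(p)\cap\partial\mathcal G_\alpha=\emptyset$, there exists a bijection $\phi:\mathcal N_\alpha(p)\to\{-1,0,1\}^2$ such that $\phi(p)=(0,0)$ and $$\phi(p_1)=(1,0),\ \phi(p_2)=(1,1),\ \phi(p_3)=(0,1),\ \phi(p_4)=(-1,1),\ \phi(p_5)=(-1,0),\ \phi(p_6)=(-1,-1),\ \phi(p_7)=(0,-1),\ \phi(p_8)=(1,-1),$$ where $p_1,\dots,p_8$ are the nearest neighbors of $p$ in $\mathcal G_\alpha$, ordered counterclockwise around $p$ (i.e. their images $X(p_j)$ around $X(p)$) and such that $|X(p_1)-X(p)|=\min\{|X(p_j)-X(p)|:j=1,\dots,8\}$. Moreover, with the convention $p_9\equiv p_1$, $$1-\alpha\le|X(p_{j+1})-X(p_j)|=1+O(\alpha)\quad\text{for every }j=1,\dots,7,$$ $$1-\alpha\le|X(p_{2j+1})-X(p)|=1+O(\alpha)\quad\text{for every }j=0,\dots,3,$$ $$|X(p_{2j})-X(p)|=\sqrt2+O(\alpha)\quad\text{for every }j=1,\dots,4,$$ $$\sqrt2+O(\alpha)\le|X(p_{2j-1})-X(p_{2j+1})|\le\sqrt2+\alpha\quad\text{for every }j=1,\dots,4.$$ In particular, there exists $C_3=C_3(\alpha_0)\in[1,\frac1{\alpha_0})$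 such that $$X(\mathcal N_\alpha(p))\sim_{C_3\alpha}\{-1,0,1\}^2,$$ where $\{-1,0,1\}^2$ is endowed with the metric induced from $\mathbb{R}^2$.
   Context: For $X:\Xi\to\mathbb{R}^2$ injective, $x_p:=X(p)$ and $\alpha>0$: $\mathcal S_\alpha:=\{\{p,q\}:p,q\in\Xi,\ |x_p-x_q|\in(1-\alpha,\sqrt2+\alpha)\}$; $\mathcal G_\alpha$ is the graph with vertex set $\Xi$ and edge set $\mathcal S_\alpha$; $\mathcal N_\alpha(p):=\{q\in\Xi:\{p,q\}\in\mathcal S_\alpha\}\cup\{p\}$; $\partial\mathcal G_\alpha:=\{p\in\Xi:\sharp\mathcal N_\alpha(p)\ne9\}$. The nearest neighbors of $p$ are the elements of $\mathcal N_\alpha(p)\setminus\{p\}$. For $\alpha\in[0,1)$ and metric spaces $(X_1,d_1),(X_2,d_2)$, $X_1\sim_\alpha X_2$ means that there is a bijection $\psi:X_1\to X_2$ with $(1-\alpha)d_1(x,y)\le d_2(\psi(x),\psi(y))\le(1+\alpha)d_1(x,y)$ for all $x,y\in X_1$. $O(\alpha)$ stands for a quantity bounded in absolute value by a continuous function of $\alpha$ alone, defined in a right neighborhood of $0$ (not depending on $X,\Xi,p$), whose quotient by $\alpha$ has finite limsup as $\alpha\to0^+$; $C_3$ likewise depends only on $\alpha_0$. *)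

theory Defs
  imports "HOL-Analysis.Analysis"
begin

text \<open>
  A configuration is an injective map \<open>X\<close> from a finite label set \<open>\<Xi>\<close> to the plane. Only the values
  of \<open>X\<close> on \<open>\<Xi>\<close> matter.
\<close>

definition edges :: "real \<Rightarrow> 'a set \<Rightarrow> ('a \<Rightarrow> real^2) \<Rightarrow> 'a set set"
  where "edges \<alpha> \<Xi> X =
    {{p, q} | p q. p \<in> \<Xi> \<and> q \<in> \<Xi> \<and> norm (X p - X q) \<in> {1 - \<alpha> <..< sqrt 2 + \<alpha>}}"

definition closed_nbhd :: "real \<Rightarrow> 'a set \<Rightarrow> ('a \<Rightarrow> real^2) \<Rightarrow> 'a \<Rightarrow> 'a set"
  where "closed_nbhd \<alpha> \<Xi> X p = {q \<in> \<Xi>. {p, q} \<in> edges \<alpha> \<Xi> X} \<union> {p}"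

definition graph_boundary :: "real \<Rightarrow> 'a set \<Rightarrow> ('a \<Rightarrow> real^2) \<Rightarrow> 'a set"
  where "graph_boundary \<alpha> \<Xi> X = {p \<in> \<Xi>. card (closed_nbhd \<alpha> \<Xi> X p) \<noteq> 9}"

text \<open>
  The relation \<open>A \<sim>\<^sub>\<alpha> B\<close> between subsets of metric spaces, each with the induced metric;
  it is meant for \<open>0 \<le> \<alpha> < 1\<close>.
\<close>

definition almost_isometric :: "real \<Rightarrow> 'a::metric_space set \<Rightarrow> 'b::metric_space set \<Rightarrow> bool"
  where "almost_isometric \<alpha> A B \<longleftrightarrow>
    (\<exists>\<psi>. bij_betw \<psi> A B \<and>
      (\<forall>x\<in>A. \<forall>y\<in>A. (1 - \<alpha>) * dist x y \<le> dist (\<psi> x) (\<psi> y) \<and>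
                   dist (\<psi> x) (\<psi> y) \<le> (1 + \<alpha>) * dist x y))"

definition grid3 :: "(real^2) set"
  where "grid3 = {v. \<forall>i. v $ i \<in> {-1, 0, 1}}"

text \<open>
  The points \<open>y 1, \<dots>, y n\<close> lie in counterclockwise order around \<open>c\<close>: they have polar angles
  with respect to \<open>c\<close> that increase strictly and span less than one full turn. The starting
  direction is arbitrary.
\<close>

definition counterclockwise :: "nat \<Rightarrow> real^2 \<Rightarrow> (nat \<Rightarrow> real^2) \<Rightarrow> bool"
  where "counterclockwise n c y \<longleftrightarrow>
    (\<exists>r \<theta> :: nat \<Rightarrow> real.
      (\<forall>j\<in>{1..n}. r j > 0 \<and> y j - c = r j *\<^sub>R vector [cos (\<theta> j), sin (\<theta> j)]) \<and>
      strict_mono_on {1..n} \<theta> \<and> \<theta> n < \<theta> 1 + 2 * pi)"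

text \<open>
  A labelling \<open>P 1, \<dots>, P 8\<close> of the nearest neighbors of \<open>p\<close>, counterclockwise and starting
  from one that is closest to \<open>p\<close>. The equation for \<open>P 9\<close> is the cyclic convention for indices.
\<close>

definition nbr_labelling ::
    "real \<Rightarrow> 'a set \<Rightarrow> ('a \<Rightarrow> real^2) \<Rightarrow> 'a \<Rightarrow> (nat \<Rightarrow> 'a) \<Rightarrow> bool"
  where "nbr_labelling \<alpha> \<Xi> X p P \<longleftrightarrow>
    bij_betw P {1..8} (closed_nbhd \<alpha> \<Xi> X p - {p}) \<and>
    counterclockwise 8 (X p) (\<lambda>j. X (P j)) \<and>
    norm (X (P 1) - X p) = Min ((\<lambda>j. norm (X (P j) - X p)) ` {1..8}) \<and>
    P 9 = P 1"

text \<open>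
  An \<open>O(\<alpha>)\<close> term is a quantity \<open>t\<close> with \<open>\<bar>t\<bar> \<le> \<omega> \<alpha>\<close>, where \<open>\<omega>\<close> is as follows. The right
  neighborhood of \<open>0\<close> on which \<open>\<omega>\<close> is considered is \<open>{0..<\<alpha>0}\<close>.
\<close>

definition linear_modulus :: "real \<Rightarrow> (real \<Rightarrow> real) \<Rightarrow> bool"
  where "linear_modulus \<alpha>0 \<omega> \<longleftrightarrow>
    continuous_on {0..<\<alpha>0} \<omega> \<and> (\<forall>\<alpha>\<in>{0..<\<alpha>0}. \<omega> \<alpha> \<ge> 0) \<and>
    Limsup (at_right 0) (\<lambda>\<alpha>. ereal (\<omega> \<alpha> / \<alpha>)) < \<infinity>"

end

theory Submission
  imports Defs
begin

text \<open>
  Place \<open>p\<close> at the origin of the complex plane and let \<open>y 0, \<dots>, y 7\<close> be its eight neighbors,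
  counterclockwise; indices are read modulo \<open>8\<close>. Angles alone do not force these points to
  look like the square grid (a regular octagon of radius \<open>sqrt 2\<close> is an admissible link), so
  the proof uses that every \<open>y j\<close> has eight neighbors as well.

  Two edges that cross are rigid: four points at mutual distance at least \<open>1 - \<alpha>\<close> whose
  diagonals are at most \<open>sqrt 2 + \<alpha>\<close> and intersect form a unit square up to an error linear
  in \<open>\<alpha>\<close> (\<open>crossing_estimates\<close>). It therefore suffices to produce crossings. Call \<open>m\<close>
  \<^emph>\<open>crossed\<close> if the edge from \<open>y (m - 1)\<close> to \<open>y (m + 1)\<close> crosses the spoke to \<open>y m\<close>.

  The crossings come from counting directions. Any two neighbors of a point are seen from it
  under an angle of at least \<open>0.715\<close>, slightly below \<open>arccos (3/4)\<close>. Seen from \<open>y j\<close>, the only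
  neighbors strictly inside the octagon angle at \<open>y j\<close> are the origin and, if \<open>j + 1\<close> or
  \<open>j - 1\<close> is crossed, \<open>y (j + 2)\<close> or \<open>y (j - 2)\<close>; all others lie in the outer sector
  (\<open>outer_sector\<close>). The eight outer angles of an octagon sum to \<open>10 \<pi>\<close>. If \<open>k\<close> of the
  indices are crossed, then these sectors have to accommodate at least \<open>48 - 2 k\<close> gaps of size
  \<open>0.715\<close>, and this gives \<open>k \<ge> 3\<close>.

  Adjacent indices cannot both be crossed, since a crossed spoke is about \<open>sqrt 2\<close> long and the
  spokes next to it are about \<open>1\<close> long. Three crossed indices thus follow each other at
  cyclic distances \<open>2, 3, 3\<close> or \<open>2, 2, 4\<close>. In the first case the angles at the origin are too
  large (three right angles and two angles of about \<open>60\<close> degrees); in the second case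
  the same count, restricted to the three remaining corners, shows that the fourth index is
  crossed too (\<open>fourth_crossed\<close>). So four squares surround the origin, and chaining the
  almost quarter turns between them puts all eight points within \<open>200 \<alpha>\<close> of a rotated grid
  (\<open>near_grid\<close>). The first neighbor is a closest one, hence it ends a spoke of length about \<open>1\<close>,
  and this fixes the labelling. All error terms are then at most \<open>400 \<alpha>\<close>.
\<close>

section \<open>Angles between neighbors\<close>

lemma cos_lower_bound: "1 - x^2/2 + x^4/24 - x^6/720 \<le> cos (x::real)"
proof -
  obtain t where t: "cos x = (\<Sum>m<6. cos_coeff m * x ^ m) + (cos(t + 1/2 * real 6 * pi) / fact 6) * x ^ 6"
    using Maclaurin_cos_expansion[of x 6] by blast
  have s: "(\<Sum>m<6. cos_coeff m * x ^ m) = 1 - x^2/2 + x^4/24"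
    by (simp add: cos_coeff_def lessThan_nat_numeral fact_numeral)
  have "- 1 * (x^6/720) \<le> cos(t + 1/2 * real 6 * pi) * (x^6/720)"
    by (intro mult_right_mono) (auto simp: zero_le_even_power)
  then show ?thesis unfolding t s by (simp add: fact_numeral)
qed

definition cross :: "complex \<Rightarrow> complex \<Rightarrow> real"
  where "cross u v = Re u * Im v - Im u * Re v"

lemma inner_rcis: "rcis r a \<bullet> rcis s b = r * s * cos (b - a)"
  by (simp add: inner_complex_def cos_diff algebra_simps)

lemma cross_rcis: "cross (rcis r a) (rcis s b) = r * s * sin (b - a)"
  by (simp add: cross_def sin_diff algebra_simps)

lemma cross_linear [simp]:
  "cross u (v + w) = cross u v + cross u w" "cross (u + v) w = cross u w + cross v w"
  "cross u (v - w) = cross u v - cross u w" "cross (u - v) w = cross u w - cross v w"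
  "cross u (x *\<^sub>R v) = x * cross u v" "cross (x *\<^sub>R u) v = x * cross u v"
  "cross u u = 0" "cross u (- v) = - cross u v" "cross (- u) v = - cross u v"
  "cross u 0 = 0" "cross 0 u = 0"
  by (simp_all add: cross_def algebra_simps)

lemma norm_diff_sq:
  fixes u v :: "'a::real_inner"
  shows "(norm (u - v))\<^sup>2 = (norm u)\<^sup>2 + (norm v)\<^sup>2 - 2 * (u \<bullet> v)"
  by (simp add: power2_norm_eq_inner inner_simps inner_commute)

text \<open>
  The bound on the cosine of the angle between two neighbors. With \<open>d\<close> at its minimum
  the claim reads \<open>r\<^sup>2 + s\<^sup>2 - d\<^sup>2 \<le> 1.51 r s\<close>. The difference of the two sides is convex in \<open>r\<close>
  and in \<open>s\<close>, so the corners of the square of admissible lengths decide, and the worst one is \<open>r = s\<close>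
  maximal, where the cosine is about \<open>3/4\<close>. The numbers \<open>0.999\<close> and \<open>1.4153\<close> enclose all edge
  lengths for \<open>\<alpha> \<le> 1/1000\<close>.
\<close>

lemma inner_product_bound:
  fixes r s d x :: real
  assumes r: "999/1000 \<le> r" "r \<le> 14153/10000" and s: "999/1000 \<le> s" "s \<le> 14153/10000" and d: "999/1000 \<le> d"
    and x: "d\<^sup>2 = r\<^sup>2 + s\<^sup>2 - 2 * x"
  shows "x \<le> (755/1000) * (r * s)"
proof -
  have d2: "(999/1000)\<^sup>2 \<le> d\<^sup>2" using d by (intro power_mono) auto
  have q: "(x - (999/1000)) * ((14153/10000) - x) = (24143/10000) * x - (999/1000)*(14153/10000) - x\<^sup>2" for x :: real
    by (simp add: power2_eq_square field_simps)
  have "(r - (999/1000)) * ((14153/10000) - r) \<ge> 0" "(s - (999/1000)) * ((14153/10000) - s) \<ge> 0"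
    using r s by auto
  then have rs: "r\<^sup>2 \<le> (24143/10000) * r - (999/1000)*(14153/10000)" "s\<^sup>2 \<le> (24143/10000) * s - (999/1000)*(14153/10000)"
    using q[of r] q[of s] by auto
  \<comment> \<open>the remaining bilinear expression is nonnegative at the corners of the square\<close>
  have e: "(r - a) * (s - b) = r * s - b * r - a * s + a * b" for a b
    by (simp add: algebra_simps)
  have "(r - (999/1000)) * (s - (999/1000)) \<ge> 0" "(r - (14153/10000)) * (s - (14153/10000)) \<ge> 0"
    "(r - (999/1000)) * (s - (14153/10000)) \<le> 0" "(r - (14153/10000)) * (s - (999/1000)) \<le> 0"
    using r s by (auto intro: mult_nonpos_nonpos mult_nonneg_nonpos mult_nonpos_nonneg)
  then have "(24143/10000) * (r + s) - 2*(999/1000)*(14153/10000) - (999/1000)\<^sup>2 \<le> (151/100) * (r * s)"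
    unfolding e by (simp add: power2_eq_square) argo
  with rs d2 x show ?thesis by (simp add: algebra_simps)
qed

text \<open>
  The number \<open>0.715\<close> lies below \<open>arccos 0.755\<close> and still satisfies \<open>44 * 0.715 > 10 \<pi>\<close>, which is
  what the counting argument needs.
\<close>

lemma direction_separation:
  assumes r: "999/1000 \<le> r" "r \<le> 14153/10000" and s: "999/1000 \<le> s" "s \<le> 14153/10000"
    and d: "999/1000 \<le> cmod (rcis r a - rcis s b)" and ab: "a \<le> b"
  shows "715/1000 \<le> b - a"
proof (rule ccontr)
  assume n: "\<not> (715/1000) \<le> b - a"
  have "cos (715/1000) < cos (b - a)"
    using n ab pi_approx by (intro cos_monotone_0_pi) auto
  moreover have "(755/1000) < cos ((715/1000)::real)"
    by (rule less_le_trans[OF _ cos_lower_bound]) (simp add: eval_nat_numeral)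
  moreover have "rcis r a \<bullet> rcis s b \<le> (755/1000) * (r * s)"
    using norm_diff_sq[of "rcis r a" "rcis s b"] r s d
    by (intro inner_product_bound[OF r s d]) (auto simp: rcis_def norm_mult)
  then have "r * s * cos (b - a) \<le> r * s * (755/1000)" by (simp add: inner_rcis)
  then have "cos (b - a) \<le> 755/1000"
    using r s by (subst (asm) mult_le_cancel_left_pos) auto
  ultimately show False by simp
qed

lemma card_separated_in_interval:
  fixes A :: "real set"
  assumes "finite A" "A \<subseteq> {a..b}" "\<And>x y. x \<in> A \<Longrightarrow> y \<in> A \<Longrightarrow> x < y \<Longrightarrow> \<delta> \<le> y - x" "a \<le> b + \<delta>"
  shows "(real (card A) - 1) * \<delta> \<le> b - a"
  using assms
proof (induction "card A" arbitrary: A b)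
  case 0
  then show ?case by simp
next
  case (Suc n)
  then have ne: "A \<noteq> {}" by auto
  define M where "M = Max A"
  have M: "M \<in> A" "\<And>x. x \<in> A \<Longrightarrow> x \<le> M" using ne Suc.prems(1) by (auto simp: M_def)
  have c: "card (A - {M}) = n" using Suc.hyps(2) M Suc.prems(1) by simp
  have "(real (card (A - {M})) - 1) * \<delta> \<le> (M - \<delta>) - a"
  proof (rule Suc.hyps(1)[OF c[symmetric]])
    show "A - {M} \<subseteq> {a..M - \<delta>}"
    proof
      fix x assume x: "x \<in> A - {M}"
      then have "x < M" using M by force
      then have "\<delta> \<le> M - x" using x M Suc.prems(3) by auto
      then show "x \<in> {a..M - \<delta>}" using x Suc.prems(2) by auto
    qed
  qed (use Suc.prems M in auto)
  moreover have "M \<le> b" using M Suc.prems(2) by auto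
  ultimately show ?case unfolding c Suc.hyps(2)[symmetric] by (simp add: algebra_simps)
qed

lemma rcis_between:
  assumes "a < t" "t < b" "b < a + pi" "0 < r" "0 < s" "0 < q"
  obtains x y where "0 < x" "0 < y" "rcis q t = x *\<^sub>R rcis r a + y *\<^sub>R rcis s b"
proof
  have p: "sin (b - a) > 0" "sin (b - t) > 0" "sin (t - a) > 0"
    using assms by (auto intro!: sin_gt_zero)
  show "0 < q * sin (b - t) / (r * sin (b - a))" "0 < q * sin (t - a) / (s * sin (b - a))"
    using p assms by auto
  have e: "sin (b - a) * cos t = sin (b - t) * cos a + sin (t - a) * cos b"
    "sin (b - a) * sin t = sin (b - t) * sin a + sin (t - a) * sin b"
    using sin_cos_squared_add[of t]
    by (simp_all add: sin_diff algebra_simps)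
  have r: "cos t = (sin (b - t) * cos a + sin (t - a) * cos b) / sin (b - a)"
    "sin t = (sin (b - t) * sin a + sin (t - a) * sin b) / sin (b - a)"
    using p unfolding e[symmetric] by auto
  show "rcis q t = (q * sin (b - t) / (r * sin (b - a))) *\<^sub>R rcis r a
      + (q * sin (t - a) / (s * sin (b - a))) *\<^sub>R rcis s b"
    unfolding complex_eq_iff using assms(4-6) p
    by (simp add: r field_simps)
qed

section \<open>Crossing edges and right angles\<close>

text \<open>
  Rigidity of crossing edges. Let \<open>o\<close> be the intersection point, \<open>D\<close> the largest and \<open>m\<close> the
  smallest admissible square of a length. Computing the distance from each corner to \<open>o\<close> along its own diagonal and,
  by Stewart's identity, from the other two corners gives four inequalities such as
  \<open>m \<le> (t\<^sup>2 + s (1 - s)) D\<close>, where \<open>m / D\<close> is nearly \<open>1/2\<close>. Together they leave only \<open>s\<close> and \<open>t\<close>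
  within \<open>4 \<alpha>\<close> of \<open>1/2\<close>, so \<open>o\<close> is almost the midpoint of both diagonals. Then the parallelogram
  law, with the defect \<open>a + c - b - d\<close>, turns the one-sided bounds on sides and
  diagonals into two-sided ones.
\<close>

lemma crossing_estimates:
  fixes a b c d :: "'a::real_inner"
  assumes \<alpha>: "0 < \<alpha>" "\<alpha> \<le> 1/1000"
    and sides: "1 - \<alpha> \<le> norm (a - b)" "1 - \<alpha> \<le> norm (b - c)" "1 - \<alpha> \<le> norm (c - d)" "1 - \<alpha> \<le> norm (d - a)"
    and diags: "norm (a - c) \<le> sqrt 2 + \<alpha>" "norm (b - d) \<le> sqrt 2 + \<alpha>"
    and st: "0 < s" "s < 1" "0 < t" "t < 1"
    and o: "(1 - s) *\<^sub>R a + s *\<^sub>R c = (1 - t) *\<^sub>R b + t *\<^sub>R d"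
  shows "(norm (a - b))\<^sup>2 \<le> 1 + 13 * \<alpha>" "(norm (b - c))\<^sup>2 \<le> 1 + 13 * \<alpha>"
    "(norm (c - d))\<^sup>2 \<le> 1 + 13 * \<alpha>" "(norm (d - a))\<^sup>2 \<le> 1 + 13 * \<alpha>"
    "2 - 12 * \<alpha> \<le> (norm (a - c))\<^sup>2" "2 - 12 * \<alpha> \<le> (norm (b - d))\<^sup>2"
    "norm (a + c - b - d) \<le> 24 * \<alpha>"
proof -
  define D m where "D = (sqrt 2 + \<alpha>)\<^sup>2" and "m = (1 - \<alpha>)\<^sup>2"
  define D1 D2 where "D1 = (norm (a - c))\<^sup>2" and "D2 = (norm (b - d))\<^sup>2"
  have q2: "sqrt 2 \<le> 14143/10000" by (rule real_le_lsqrt) (auto simp: power2_eq_square)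
  have D: "D \<le> 2 + 3 * \<alpha>"
  proof -
    have "D = 2 + \<alpha> * (2 * sqrt 2 + \<alpha>)" by (simp add: D_def power2_eq_square algebra_simps)
    also have "\<alpha> * (2 * sqrt 2 + \<alpha>) \<le> \<alpha> * 3" using q2 \<alpha> by (intro mult_left_mono) auto
    finally show ?thesis by simp
  qed
  have m: "1 - 2 * \<alpha> \<le> m" by (simp add: m_def power2_eq_square algebra_simps)
  have sq: "m \<le> (norm (a - b))\<^sup>2" "m \<le> (norm (b - c))\<^sup>2" "m \<le> (norm (c - d))\<^sup>2" "m \<le> (norm (d - a))\<^sup>2"
    unfolding m_def using sides \<alpha> by (auto intro!: power_mono)
  have DD: "D1 \<le> D" "D2 \<le> D" unfolding D_def D1_def D2_def using diags by (auto intro!: power_mono)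
  have D0: "0 \<le> D1" "0 \<le> D2" "0 \<le> D" by (auto simp: D1_def D2_def D_def)
  have stewart: "(norm (x - ((1 - k) *\<^sub>R u + k *\<^sub>R v)))\<^sup>2
      = (1 - k) * (norm (x - u))\<^sup>2 + k * (norm (x - v))\<^sup>2 - k * (1 - k) * (norm (u - v))\<^sup>2"
    for x u v :: 'a and k
    by (simp add: power2_norm_eq_inner inner_simps inner_commute algebra_simps)
  have wm: "m \<le> (1 - k) * p + k * q" if "0 < k" "k < 1" "m \<le> p" "m \<le> q" for k p q
  proof -
    have "(1 - k) * m \<le> (1 - k) * p" "k * m \<le> k * q" using that by auto
    then show ?thesis by (simp add: algebra_simps)
  qed
  have nc: "norm (b - a) = norm (a - b)" "norm (c - b) = norm (b - c)" "norm (d - c) = norm (c - d)"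
     "norm (a - d) = norm (d - a)"
    by (simp_all add: norm_minus_commute)
  have bo: "b - ((1 - s) *\<^sub>R a + s *\<^sub>R c) = t *\<^sub>R (b - d)"
    "d - ((1 - s) *\<^sub>R a + s *\<^sub>R c) = (t - 1) *\<^sub>R (b - d)"
    unfolding o by (simp_all add: algebra_simps)
  have ao: "a - ((1 - t) *\<^sub>R b + t *\<^sub>R d) = s *\<^sub>R (a - c)"
    "c - ((1 - t) *\<^sub>R b + t *\<^sub>R d) = (s - 1) *\<^sub>R (a - c)"
    unfolding o[symmetric] by (simp_all add: algebra_simps)
  have e1: "m \<le> t\<^sup>2 * D2 + s * (1 - s) * D1"
    using stewart[of b s a c] wm[OF st(1,2) sq(1,2)] unfolding bo D1_def D2_def nc
    by (simp add: power_mult_distrib)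
  have e2: "m \<le> (1 - t)\<^sup>2 * D2 + s * (1 - s) * D1"
    using stewart[of d s a c] wm[OF st(1,2) sq(4,3)] unfolding bo D1_def D2_def nc
    by (simp add: power_mult_distrib power2_commute)
  have e3: "m \<le> s\<^sup>2 * D1 + t * (1 - t) * D2"
    using stewart[of a t b d] wm[OF st(3,4) sq(1,4)] unfolding ao D1_def D2_def nc
    by (simp add: power_mult_distrib)
  have e4: "m \<le> (1 - s)\<^sup>2 * D1 + t * (1 - t) * D2"
    using stewart[of c t b d] wm[OF st(3,4) sq(2,3)] unfolding ao D1_def D2_def nc
    by (simp add: power_mult_distrib power2_commute)
  have mono: "1/2 - 2 * \<alpha> \<le> x + y" if "m \<le> x * E + y * F" "E \<le> D" "F \<le> D" "0 \<le> x" "0 \<le> y" for x y E F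
  proof (rule ccontr)
    assume n: "\<not> 1/2 - 2 * \<alpha> \<le> x + y"
    have "m \<le> x * D + y * D" using that mult_left_mono[of E D x] mult_left_mono[of F D y] by linarith
    also have "\<dots> = (x + y) * D" by (simp add: algebra_simps)
    also have "\<dots> \<le> (1/2 - 2 * \<alpha>) * (2 + 3 * \<alpha>)" using n D D0 that \<alpha> by (intro mult_mono) auto
    also have "\<dots> < 1 - 2 * \<alpha>"
    proof -
      have "(1/2 - 2 * \<alpha>) * (2 + 3 * \<alpha>) = 1 - 5/2 * \<alpha> - 6 * \<alpha>\<^sup>2" by (simp add: power2_eq_square algebra_simps)
      then show ?thesis using \<alpha> zero_le_power2[of \<alpha>] by linarith
    qed
    finally show False using m by simp
  qed
  have f: "1/2 - 2 * \<alpha> \<le> t\<^sup>2 + s * (1 - s)" "1/2 - 2 * \<alpha> \<le> (1 - t)\<^sup>2 + s * (1 - s)"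
    "1/2 - 2 * \<alpha> \<le> s\<^sup>2 + t * (1 - t)" "1/2 - 2 * \<alpha> \<le> (1 - s)\<^sup>2 + t * (1 - t)"
    using mono[OF e1 DD(2,1)] mono[OF e2 DD(2,1)] mono[OF e3 DD] mono[OF e4 DD] st by auto
  then have t: "\<bar>1 - 2 * t\<bar> \<le> 8 * \<alpha>" and s: "\<bar>1 - 2 * s\<bar> \<le> 8 * \<alpha>"
    by (auto simp: power2_eq_square algebra_simps)
  have n15: "norm (a - c) \<le> 3/2" "norm (b - d) \<le> 3/2" using diags q2 \<alpha> by auto
  have weq: "a + c - b - d = (1 - 2 * t) *\<^sub>R (b - d) - (1 - 2 * s) *\<^sub>R (a - c)"
  proof -
    have "a + c - b - d = (1 - 2 * t) *\<^sub>R (b - d) - (1 - 2 * s) *\<^sub>R (a - c)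
        + 2 *\<^sub>R (((1 - s) *\<^sub>R a + s *\<^sub>R c) - ((1 - t) *\<^sub>R b + t *\<^sub>R d))"
      by (simp add: algebra_simps scaleR_2)
    then show ?thesis unfolding o by simp
  qed
  have "norm (a + c - b - d) \<le> norm ((1 - 2 * t) *\<^sub>R (b - d)) + norm ((1 - 2 * s) *\<^sub>R (a - c))"
    unfolding weq by (rule norm_triangle_ineq4)
  also have "\<dots> \<le> (8 * \<alpha>) * (3/2) + (8 * \<alpha>) * (3/2)"
    unfolding norm_scaleR using t s n15 by (intro add_mono mult_mono) auto
  finally show w: "norm (a + c - b - d) \<le> 24 * \<alpha>" by simp
  then have "(norm (a + c - b - d))\<^sup>2 \<le> (24 * \<alpha>)\<^sup>2" by (intro power_mono) auto
  also have "\<dots> \<le> \<alpha>" using \<alpha> by (simp add: power2_eq_square)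
  finally have w2: "(norm (a + c - b - d))\<^sup>2 \<le> \<alpha>" .
  have para: "(norm (a - b))\<^sup>2 + (norm (b - c))\<^sup>2 + (norm (c - d))\<^sup>2 + (norm (d - a))\<^sup>2
      = D1 + D2 + (norm (a + c - b - d))\<^sup>2"
  proof -
    have "(norm u)\<^sup>2 + (norm v)\<^sup>2 + (norm w)\<^sup>2 + (norm (u + v + w))\<^sup>2
        = (norm (u + v))\<^sup>2 + (norm (v + w))\<^sup>2 + (norm (u + w))\<^sup>2" for u v w :: 'a
      by (simp add: power2_norm_eq_inner inner_add_left inner_add_right inner_commute)
    from this[of "a - b" "b - c" "c - d"] show ?thesis
      unfolding D1_def D2_def by (simp add: norm_minus_commute algebra_simps)
  qed
  have sq': "1 - 2 * \<alpha> \<le> (norm (a - b))\<^sup>2" "1 - 2 * \<alpha> \<le> (norm (b - c))\<^sup>2"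
    "1 - 2 * \<alpha> \<le> (norm (c - d))\<^sup>2" "1 - 2 * \<alpha> \<le> (norm (d - a))\<^sup>2"
    using sq m by (auto intro: order_trans)
  have "D1 \<le> 2 + 3 * \<alpha>" "D2 \<le> 2 + 3 * \<alpha>" using DD D by auto
  then show "(norm (a - b))\<^sup>2 \<le> 1 + 13 * \<alpha>" "(norm (b - c))\<^sup>2 \<le> 1 + 13 * \<alpha>"
    "(norm (c - d))\<^sup>2 \<le> 1 + 13 * \<alpha>" "(norm (d - a))\<^sup>2 \<le> 1 + 13 * \<alpha>"
    "2 - 12 * \<alpha> \<le> (norm (a - c))\<^sup>2" "2 - 12 * \<alpha> \<le> (norm (b - d))\<^sup>2"
    using para w2 sq' unfolding D1_def[symmetric] D2_def[symmetric] by linarith+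
qed

text \<open>
  The error is \<open>O(\<alpha>)\<close>, and not merely \<open>O(sqrt \<alpha>)\<close>: by Lagrange's identity the cross product differs
  from the product of the lengths only by a quantity of the order of the squared inner product.
\<close>

lemma near_quarter_turn:
  assumes \<alpha>: "0 < \<alpha>" "\<alpha> \<le> 1/1000"
    and u: "1 - \<alpha> \<le> cmod u" "(cmod u)\<^sup>2 \<le> 1 + 13 * \<alpha>"
    and v: "1 - \<alpha> \<le> cmod v" "(cmod v)\<^sup>2 \<le> 1 + 13 * \<alpha>"
    and dot: "\<bar>u \<bullet> v\<bar> \<le> 19 * \<alpha>" and cr: "0 < cross u v"
  shows "cmod (v - \<i> * u) \<le> 30 * \<alpha>"
proof -
  have up: "x \<le> 1 + 7 * \<alpha>" if "x\<^sup>2 \<le> 1 + 13 * \<alpha>" for x :: real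
  proof (rule power2_le_imp_le)
    have "(1 + 7 * \<alpha>)\<^sup>2 = 1 + 14 * \<alpha> + 49 * \<alpha>\<^sup>2" by (simp add: power2_eq_square algebra_simps)
    then show "x\<^sup>2 \<le> (1 + 7 * \<alpha>)\<^sup>2" using that \<alpha> zero_le_power2[of \<alpha>] by linarith
  qed (use \<alpha> in auto)
  define p q where "p = cmod u" and "q = cmod v"
  have pq: "1 - \<alpha> \<le> p" "p \<le> 1 + 7 * \<alpha>" "1 - \<alpha> \<le> q" "q \<le> 1 + 7 * \<alpha>"
    using u v up by (auto simp: p_def q_def)
  have lag: "(cross u v)\<^sup>2 + (u \<bullet> v)\<^sup>2 = (p * q)\<^sup>2"
    unfolding p_def q_def power_mult_distrib cmod_power2 cross_def inner_complex_def
    by (simp add: power2_eq_square algebra_simps)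
  have pq0: "9/10 \<le> p * q"
  proof -
    have "((999/1000)::real) * (999/1000) \<le> p * q" using pq \<alpha> by (intro mult_mono) auto
    then show ?thesis by simp
  qed
  have "(p * q - cross u v) * (p * q + cross u v) = (u \<bullet> v)\<^sup>2"
    using lag by (simp add: power2_eq_square algebra_simps)
  moreover have "(u \<bullet> v)\<^sup>2 \<le> (19 * \<alpha>)\<^sup>2" using dot \<alpha> by (simp only: power2_le_iff_abs_le[of "19 * \<alpha>"])
  ultimately have A: "(p * q - cross u v) * (p * q + cross u v) \<le> 361 * \<alpha>\<^sup>2"
    by (simp add: power_mult_distrib)
  have le: "cross u v \<le> p * q"
  proof (rule power2_le_imp_le)
    show "(cross u v)\<^sup>2 \<le> (p * q)\<^sup>2" using lag zero_le_power2[of "u \<bullet> v"] by linarith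
    show "0 \<le> p * q" using pq0 by linarith
  qed
  have "(p * q - cross u v) * (9/10) \<le> (p * q - cross u v) * (p * q + cross u v)"
    using le cr pq0 by (intro mult_left_mono) auto
  then have "(p * q - cross u v) * (9/10) \<le> 361 * \<alpha>\<^sup>2" using A by (rule order_trans)
  then have B: "p * q - cross u v \<le> 402 * \<alpha>\<^sup>2" using zero_le_power2[of \<alpha>]
    unfolding left_diff_distrib by linarith
  have C: "(p - q)\<^sup>2 \<le> (8 * \<alpha>)\<^sup>2"
    using pq \<alpha> by (subst power2_le_iff_abs_le) auto
  have "(cmod (v - \<i> * u))\<^sup>2 = p\<^sup>2 + q\<^sup>2 - 2 * cross u v"
    unfolding p_def q_def cmod_power2 cross_def by (simp add: power2_eq_square algebra_simps)
  also have "\<dots> = (p - q)\<^sup>2 + 2 * (p * q - cross u v)" by (simp add: power2_eq_square algebra_simps)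
  also have "\<dots> \<le> (30 * \<alpha>)\<^sup>2"
  proof -
    have "(30 * \<alpha>)\<^sup>2 = 900 * \<alpha>\<^sup>2" "(8 * \<alpha>)\<^sup>2 = 64 * \<alpha>\<^sup>2" by (simp_all add: power_mult_distrib)
    then show ?thesis using B C zero_le_power2[of \<alpha>] unfolding right_diff_distrib by linarith
  qed
  finally show ?thesis by (rule power2_le_imp_le) (use \<alpha> in simp)
qed

section \<open>The octagon of neighbors\<close>

lemma sin_pos_imp:
  assumes "0 \<le> x" "x < 2 * pi" "0 < sin x"
  shows "0 < x \<and> x < pi"
proof -
  have "x \<noteq> 0" using assms(3) by auto
  moreover have "x < pi"
  proof (rule ccontr)
    assume "\<not> x < pi"
    then have "x = pi \<or> pi < x" by linarith
    then show False using assms(2,3) sin_lt_zero[of x] by auto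
  qed
  ultimately show ?thesis using assms(1) by simp
qed

lemma rcis_add_3pi: "rcis r (a + 3 * pi) = - rcis r a"
  by (simp add: complex_eq_iff cos_add sin_add)

lemma rcis_add_2pi: "rcis r (a + 2 * pi) = rcis r a"
  by (simp add: complex_eq_iff cos_add sin_add)

lemma rcis_Arg2pi: "z = rcis (cmod z) (b + Arg2pi (z * cis (- b)))"
proof -
  have "z * cis (- b) = rcis (cmod z) (Arg2pi (z * cis (- b)))"
    using cos_Arg2pi[of "z * cis (- b)"] sin_Arg2pi[of "z * cis (- b)"]
    by (intro complex_eqI) (simp_all add: norm_mult)
  then have "z * cis (- b) * cis b = rcis (cmod z) (Arg2pi (z * cis (- b))) * cis b" by simp
  moreover have "z * cis (- b) * cis b = z" by (simp add: mult.assoc cis_mult)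
  ultimately show ?thesis by (simp add: rcis_def mult.assoc cis_mult add.commute)
qed

text \<open>
  The situation around \<open>p\<close>, with \<open>p\<close> moved to the origin. The neighbors and their polar angles are indexed by
  all integers, so that cyclic shifts need no case distinction and the angles
  increase along the whole sequence.
\<close>

locale octet =
  fixes \<alpha> :: real and S :: "complex set" and y :: "int \<Rightarrow> complex" and \<theta> :: "int \<Rightarrow> real"
  assumes alpha: "0 < \<alpha>" "\<alpha> \<le> 1/1000"
    and separated: "\<And>x z. x \<in> S \<Longrightarrow> z \<in> S \<Longrightarrow> x \<noteq> z \<Longrightarrow> 1 - \<alpha> < cmod (x - z)"
    and zero_in: "0 \<in> S"
    and ring: "{z \<in> S. z \<noteq> 0 \<and> cmod z < sqrt 2 + \<alpha>} = range y"
    and y_period: "\<And>i. y (i + 8) = y i"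
    and th_period: "\<And>i. \<theta> (i + 8) = \<theta> i + 2 * pi"
    and polar: "\<And>i. y i = rcis (cmod (y i)) (\<theta> i)"
    and increasing: "strict_mono \<theta>"
    and degree: "\<And>i. card {z \<in> S. z \<noteq> y i \<and> cmod (z - y i) < sqrt 2 + \<alpha>} = 8"
begin

lemma sqrt2_bounds: "1414/1000 \<le> sqrt 2" "sqrt 2 \<le> 14143/10000"
  by (rule real_le_rsqrt, simp add: power2_eq_square) (rule real_le_lsqrt, simp_all add: power2_eq_square)

lemma edge_bound: "x < sqrt 2 + \<alpha> \<Longrightarrow> x \<le> 14153/10000"
  using sqrt2_bounds alpha by simp

lemma separated_rat: "x \<in> S \<Longrightarrow> z \<in> S \<Longrightarrow> x \<noteq> z \<Longrightarrow> (999/1000) \<le> cmod (x - z)"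
  using separated[of x z] alpha by simp

lemma y_props: "y i \<in> S" "y i \<noteq> 0" "cmod (y i) < sqrt 2 + \<alpha>" "1 - \<alpha> < cmod (y i)"
  "999/1000 \<le> cmod (y i)" "cmod (y i) \<le> 14153/10000"
proof -
  have "y i \<in> range y" by simp
  then show "y i \<in> S" "y i \<noteq> 0" "cmod (y i) < sqrt 2 + \<alpha>" unfolding ring[symmetric] by auto
  then show "1 - \<alpha> < cmod (y i)" "999/1000 \<le> cmod (y i)" "cmod (y i) \<le> 14153/10000"
    using separated[of "y i" 0] separated_rat[of "y i" 0] zero_in edge_bound by auto
qed

lemma y_period_mult: "y (i + 8 * n) = y i"
proof -
  have nat: "y (i + 8 * int k) = y i" for i k
  proof (induction k)
    case (Suc k)
    then show ?case using y_period[of "i + 8 * int k"] by (simp add: algebra_simps)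
  qed simp
  show ?thesis
  proof (cases "0 \<le> n")
    case True
    then show ?thesis using nat[of i "nat n"] by simp
  next
    case False
    then show ?thesis using nat[of "i + 8 * n" "nat (- n)"] by simp
  qed
qed

lemma neighbor_index:
  assumes "z \<in> S" "z \<noteq> 0" "cmod z < sqrt 2 + \<alpha>"
  obtains k where "i \<le> k" "k < i + 8" "z = y k"
proof -
  obtain m where m: "z = y m" using assms ring by auto
  have "m = (i + (m - i) mod 8) + 8 * ((m - i) div 8)"
    using mult_div_mod_eq[of 8 "m - i"] by linarith
  then have "z = y (i + (m - i) mod 8)" using y_period_mult m by metis
  moreover have "0 \<le> (m - i) mod 8" "(m - i) mod 8 < 8" by simp_all
  ultimately show thesis using that[of "i + (m - i) mod 8"] by simp
qed

lemma direction_less: "i < j \<Longrightarrow> \<theta> i < \<theta> j"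
  using increasing by (simp add: strict_monoD)

lemma inner_y: "y i \<bullet> y j = cmod (y i) * cmod (y j) * cos (\<theta> j - \<theta> i)"
  by (subst polar[of i], subst polar[of j]) (rule inner_rcis)

lemma cross_y: "cross (y i) (y j) = cmod (y i) * cmod (y j) * sin (\<theta> j - \<theta> i)"
  by (subst polar[of i], subst polar[of j]) (rule cross_rcis)

lemma y_distinct:
  assumes "i < j" "j < i + 8"
  shows "y i \<noteq> y j"
proof
  assume e: "y i = y j"
  have "cmod (y i) * cmod (y i) * cos (\<theta> j - \<theta> i) = cmod (y i) * cmod (y i) * 1"
    using inner_y[of i j] unfolding e[symmetric] by (simp add: dot_square_norm power2_eq_square)
  then have "cos (\<theta> j - \<theta> i) = 1" using y_props(2) by simp
  then obtain n :: int where n: "\<theta> j - \<theta> i = of_int n * 2 * pi"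
    by (auto simp: cos_one_2pi_int)
  have "0 < \<theta> j - \<theta> i" "\<theta> j - \<theta> i < 1 * (2 * pi)"
    using direction_less[OF assms(1)] direction_less[OF assms(2)] th_period[of i] by auto
  then have "0 < real_of_int n" "real_of_int n < 1"
    unfolding n by (auto simp: zero_less_mult_iff)
  then show False by simp
qed

lemma direction_gap_next: "\<theta> i + (715/1000) \<le> \<theta> (i + 1)"
proof -
  have "999/1000 \<le> cmod (rcis (cmod (y i)) (\<theta> i) - rcis (cmod (y (i + 1))) (\<theta> (i + 1)))"
    unfolding polar[symmetric] using separated_rat y_props y_distinct[of i "i + 1"] by auto
  then have "715/1000 \<le> \<theta> (i + 1) - \<theta> i"
    by (rule direction_separation[rotated 4]) (use y_props direction_less[of i "i + 1"] in auto)
  then show ?thesis by simp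
qed

lemma direction_gap: "i \<le> j \<Longrightarrow> \<theta> i + (715/1000) * real_of_int (j - i) \<le> \<theta> j"
proof (induction j rule: int_ge_induct)
  case (step j)
  have "real_of_int (j + 1 - i) = real_of_int (j - i) + 1" by simp
  then have e: "(715/1000) * real_of_int (j + 1 - i) = (715/1000) * real_of_int (j - i) + 715/1000" by simp
  show ?case unfolding e using step.IH direction_gap_next[of j] by linarith
qed simp

lemma direction_gap_upper: "j \<le> i + 8 \<Longrightarrow> \<theta> j + (715/1000) * real_of_int (i + 8 - j) \<le> \<theta> i + 2 * pi"
  using direction_gap[of j "i + 8"] th_period[of i] by simp

lemma direction_two_steps:
  assumes "k \<le> 2"
  shows "\<theta> (i + k) - \<theta> i < 2"
proof -
  have "\<theta> (i + k) \<le> \<theta> (i + 2)" using direction_less[of "i + k" "i + 2"] assms by (cases "k = 2") auto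
  then show ?thesis using direction_gap_upper[of "i + 2" i] pi_approx by simp
qed

lemma sin_gap: "0 < k \<Longrightarrow> k \<le> 2 \<Longrightarrow> 0 < sin (\<theta> (i + k) - \<theta> i)"
  using direction_less[of i "i + k"] direction_two_steps[of k i] pi_approx
  by (intro sin_gt_zero) auto

lemma cross_y_sgn:
  "0 < cross (y i) (y j) \<longleftrightarrow> 0 < sin (\<theta> j - \<theta> i)"
  "0 \<le> cross (y i) (y j) \<longleftrightarrow> 0 \<le> sin (\<theta> j - \<theta> i)"
proof -
  have p: "0 < cmod (y i) * cmod (y j)" using y_props(2) by simp
  show "0 < cross (y i) (y j) \<longleftrightarrow> 0 < sin (\<theta> j - \<theta> i)"
    "0 \<le> cross (y i) (y j) \<longleftrightarrow> 0 \<le> sin (\<theta> j - \<theta> i)"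
    unfolding cross_y
    using mult_less_cancel_left_pos[OF p, of 0] mult_le_cancel_left_pos[OF p, of 0]
    unfolding mult_zero_right by blast+
qed

lemma cross_next: "0 < k \<Longrightarrow> k \<le> 2 \<Longrightarrow> 0 < cross (y i) (y (i + k))"
  unfolding cross_y using y_props sin_gap by (intro mult_pos_pos) auto

text \<open>
  The neighbors are listed in angular order, so the sector between two consecutive ones contains
  no further neighbor. In particular the triangle with corners \<open>0\<close>, \<open>y i\<close> and \<open>y (i + 1)\<close> contains no
  other point of the configuration.
\<close>

lemma empty_sector:
  assumes z: "z \<in> S" "z \<noteq> 0" "cmod z < sqrt 2 + \<alpha>"
    and comb: "z = a *\<^sub>R y i + b *\<^sub>R y (i + 1)" "0 \<le> a" "0 < b"
  shows "z = y (i + 1)"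
proof -
  obtain k where k: "i \<le> k" "k < i + 8" "z = y k" using neighbor_index[OF z] .
  have c: "0 < cross (y i) (y (i + 1))" by (rule cross_next) auto
  have "cross (y i) z = b * cross (y i) (y (i + 1))"
    "cross z (y (i + 1)) = a * cross (y i) (y (i + 1))"
    unfolding comb(1) by simp_all
  then have "0 < cross (y i) (y k)" "0 \<le> cross (y k) (y (i + 1))"
    using c comb k(3) by auto
  then have s: "0 < sin (\<theta> k - \<theta> i)" "0 \<le> sin (\<theta> (i + 1) - \<theta> k)"
    unfolding cross_y_sgn .
  have le: "\<theta> i \<le> \<theta> k" using direction_less[of i k] k(1) by (cases "i = k") auto
  have "\<theta> k - \<theta> i < pi \<and> 0 < \<theta> k - \<theta> i"
    using sin_pos_imp[OF _ _ s(1)] le direction_less[OF k(2)] th_period[of i] by auto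
  then have kp: "\<theta> k - \<theta> i < pi" "i \<noteq> k" by auto
  have "k \<le> i + 1"
  proof (rule ccontr)
    assume "\<not> k \<le> i + 1"
    then have "\<theta> (i + 1) < \<theta> k" by (intro direction_less) auto
    moreover have "\<theta> i < \<theta> (i + 1)" by (intro direction_less) auto
    ultimately have "0 < sin (\<theta> k - \<theta> (i + 1))" using kp by (intro sin_gt_zero) auto
    then show False using s(2) sin_minus[of "\<theta> k - \<theta> (i + 1)"] by simp
  qed
  then have "k = i + 1" using k kp by auto
  then show ?thesis using k by simp
qed

text \<open>
  The coefficient condition says that the spoke to \<open>y m\<close> crosses the edge from \<open>y (m - 1)\<close> to
  \<open>y (m + 1)\<close>: dividing by \<open>a + b > 1\<close> moves \<open>y m\<close> towards the origin onto that edge. This form is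
  invariant under reflection.
\<close>

definition crossed :: "int \<Rightarrow> bool"
  where "crossed m \<longleftrightarrow> cmod (y (m + 1) - y (m - 1)) < sqrt 2 + \<alpha> \<and>
    (\<exists>a b. 0 < a \<and> 0 < b \<and> 1 < a + b \<and> y m = a *\<^sub>R y (m - 1) + b *\<^sub>R y (m + 1))"

lemma crossed_period: "crossed (m + 8 * n) = crossed m"
  unfolding crossed_def
  using y_period_mult[of m n] y_period_mult[of "m + 1" n] y_period_mult[of "m - 1" n]
  by (simp add: algebra_simps)

lemma square_norm_lower: "(cmod v)\<^sup>2 \<ge> 1 - 2 * \<alpha>" if "1 - \<alpha> \<le> cmod v"
proof -
  have "(1 - \<alpha>)\<^sup>2 \<le> (cmod v)\<^sup>2" using that alpha by (intro power_mono) auto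
  then show ?thesis by (simp add: power2_eq_square algebra_simps) (use zero_le_square[of \<alpha>] in linarith)
qed

lemma edge_square_norm: "(cmod v)\<^sup>2 \<le> 2 + 3 * \<alpha>" if "cmod v < sqrt 2 + \<alpha>"
proof -
  have "(cmod v)\<^sup>2 \<le> (sqrt 2 + \<alpha>)\<^sup>2" using that by (intro power_mono) auto
  also have "\<dots> = 2 + \<alpha> * (2 * sqrt 2 + \<alpha>)" by (simp add: power2_eq_square algebra_simps)
  also have "\<alpha> * (2 * sqrt 2 + \<alpha>) \<le> \<alpha> * 3" using sqrt2_bounds alpha by (intro mult_left_mono) auto
  finally show ?thesis by simp
qed

text \<open>
  What \<open>crossing_estimates\<close> says about the almost unit square with corners
  \<open>y (m - 1)\<close>, \<open>y m\<close>, \<open>y (m + 1)\<close>, \<open>0\<close>; the inner products follow from the lengths by the law of cosines.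
\<close>

lemma crossed_square:
  assumes "crossed m"
  shows "(cmod (y (m - 1)))\<^sup>2 \<le> 1 + 13 * \<alpha>" "(cmod (y (m + 1)))\<^sup>2 \<le> 1 + 13 * \<alpha>"
    "2 - 12 * \<alpha> \<le> (cmod (y m))\<^sup>2"
    "cmod (y (m - 1) + y (m + 1) - y m) \<le> 24 * \<alpha>"
    "\<bar>y (m - 1) \<bullet> y (m + 1)\<bar> \<le> 19 * \<alpha>"
    "\<bar>(y m - y (m - 1)) \<bullet> y (m - 1)\<bar> \<le> 19 * \<alpha>"
    "\<bar>(y m - y (m + 1)) \<bullet> y (m + 1)\<bar> \<le> 19 * \<alpha>"
proof -
  obtain a b where ab: "0 < a" "0 < b" "1 < a + b" "y m = a *\<^sub>R y (m - 1) + b *\<^sub>R y (m + 1)"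
    and e: "cmod (y (m + 1) - y (m - 1)) < sqrt 2 + \<alpha>" using assms crossed_def by auto
  define s t where "s = b / (a + b)" and "t = 1 - 1 / (a + b)"
  have st: "0 < s" "s < 1" "0 < t" "t < 1" using ab by (auto simp: s_def t_def)
  have "a + b \<noteq> 0" using ab by simp
  then have s1: "1 - s = a / (a + b)" by (simp add: s_def field_simps)
  have o: "(1 - s) *\<^sub>R y (m - 1) + s *\<^sub>R y (m + 1) = (1 - t) *\<^sub>R y m + t *\<^sub>R 0"
    unfolding s1 ab(4) by (simp add: s_def t_def scaleR_add_right)
  have d: "y (m - 1) \<noteq> y m" "y m \<noteq> y (m + 1)" using y_distinct[of "m - 1" m] y_distinct[of m "m + 1"] by auto
  have sides: "1 - \<alpha> \<le> cmod (y (m - 1) - y m)" "1 - \<alpha> \<le> cmod (y m - y (m + 1))"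
    "1 - \<alpha> \<le> cmod (y (m + 1) - 0)" "1 - \<alpha> \<le> cmod (0 - y (m - 1))"
    using separated[of "y (m - 1)" "y m"] separated[of "y m" "y (m + 1)"] y_props d
    by (auto intro: less_imp_le)
  have diags: "cmod (y (m - 1) - y (m + 1)) \<le> sqrt 2 + \<alpha>" "cmod (y m - 0) \<le> sqrt 2 + \<alpha>"
    using e y_props(3)[of m] by (auto simp: norm_minus_commute)
  note est = crossing_estimates[OF alpha sides diags st o]
  show "(cmod (y (m - 1)))\<^sup>2 \<le> 1 + 13 * \<alpha>" "(cmod (y (m + 1)))\<^sup>2 \<le> 1 + 13 * \<alpha>"
    "2 - 12 * \<alpha> \<le> (cmod (y m))\<^sup>2" "cmod (y (m - 1) + y (m + 1) - y m) \<le> 24 * \<alpha>"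
    using est by simp_all
  have d2: "(cmod (y (m - 1) - y (m + 1)))\<^sup>2 \<le> 2 + 3 * \<alpha>" "(cmod (y m))\<^sup>2 \<le> 2 + 3 * \<alpha>"
    using edge_square_norm[OF e] edge_square_norm[OF y_props(3)] by (auto simp: norm_minus_commute)
  have s2: "1 - 2 * \<alpha> \<le> (cmod (y (m - 1)))\<^sup>2" "1 - 2 * \<alpha> \<le> (cmod (y (m + 1)))\<^sup>2"
     "1 - 2 * \<alpha> \<le> (cmod (y (m - 1) - y m))\<^sup>2" "1 - 2 * \<alpha> \<le> (cmod (y m - y (m + 1)))\<^sup>2"
    using sides by (auto intro!: square_norm_lower)
  show "\<bar>y (m - 1) \<bullet> y (m + 1)\<bar> \<le> 19 * \<alpha>"
    using norm_diff_sq[of "y (m - 1)" "y (m + 1)"] est s2 d2 alpha by (simp add: abs_le_iff)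
  have i1: "(y m - y (m - 1)) \<bullet> y (m - 1) = ((cmod (y m))\<^sup>2 - (cmod (y (m - 1)))\<^sup>2 - (cmod (y (m - 1) - y m))\<^sup>2) / 2"
    unfolding norm_diff_sq inner_diff_left dot_square_norm by (simp add: inner_commute)
  show "\<bar>(y m - y (m - 1)) \<bullet> y (m - 1)\<bar> \<le> 19 * \<alpha>"
    unfolding i1 using est s2 d2 alpha by (simp add: abs_le_iff)
  have i2: "(y m - y (m + 1)) \<bullet> y (m + 1) = ((cmod (y m))\<^sup>2 - (cmod (y (m + 1)))\<^sup>2 - (cmod (y m - y (m + 1)))\<^sup>2) / 2"
    unfolding norm_diff_sq inner_diff_left dot_square_norm by (simp add: inner_commute)
  show "\<bar>(y m - y (m + 1)) \<bullet> y (m + 1)\<bar> \<le> 19 * \<alpha>"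
    unfolding i2 using est s2 d2 alpha by (simp add: abs_le_iff)
qed

text \<open>
  A neighbor \<open>z\<close> of \<open>y j\<close> whose direction lies strictly between those of the origin and of
  \<open>y (j + 1)\<close>. It cannot lie in the triangle of these points, by \<open>empty_sector\<close>. Hence the edge from \<open>y j\<close> to \<open>z\<close>
  leaves the triangle through the spoke to \<open>y (j + 1)\<close>, the crossing makes \<open>z\<close> a neighbor of the
  origin at almost a right angle from \<open>y j\<close>, and fewer than three gaps of size \<open>0.715\<close> fit in between.
\<close>

lemma inner_neighbor_forward:
  assumes z: "z \<in> S" "z \<noteq> y j" "cmod (z - y j) < sqrt 2 + \<alpha>"
    and comb: "z - y j = l *\<^sub>R (- y j) + q *\<^sub>R (y (j + 1) - y j)" "0 < l" "0 < q"
  shows "z = y (j + 2) \<and> crossed (j + 1)"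
proof -
  have c: "0 < cross (y j) (y (j + 1))" by (rule cross_next) auto
  have zeq: "z = (1 - l - q) *\<^sub>R y j + q *\<^sub>R y (j + 1)"
    using comb(1) by (simp add: algebra_simps)
  have cz: "cross (y j) z = q * cross (y j) (y (j + 1))" unfolding zeq by simp
  have c1: "cross z (y (j + 1)) = (1 - l - q) * cross (y j) (y (j + 1))" unfolding zeq by simp
  have z0: "z \<noteq> 0" using cz c comb(3) by auto
  have z1: "z \<noteq> y (j + 1)"
  proof
    assume e: "z = y (j + 1)"
    have "q = 1" using cz c unfolding e by simp
    moreover have "1 - l - q = 0" using c1 c unfolding e by simp
    ultimately show False using comb by simp
  qed
  have lq: "1 < l + q"
  proof (rule ccontr)
    assume n: "\<not> 1 < l + q"
    have "cmod z \<le> cmod ((1 - l - q) *\<^sub>R y j) + cmod (q *\<^sub>R y (j + 1))"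
      unfolding zeq by (rule norm_triangle_ineq)
    also have "\<dots> = (1 - l - q) * cmod (y j) + q * cmod (y (j + 1))" using n comb by simp
    also have "\<dots> \<le> (1 - l - q) * (sqrt 2 + \<alpha>) + q * (sqrt 2 + \<alpha>)"
      using n comb y_props(3)[of j] y_props(3)[of "j + 1"] by (intro add_mono mult_left_mono) auto
    also have "\<dots> = (1 - l) * (sqrt 2 + \<alpha>)" by (simp add: algebra_simps)
    also have "\<dots> < 1 * (sqrt 2 + \<alpha>)" using comb(2) alpha sqrt2_bounds by (intro mult_strict_right_mono) auto
    finally have "z = y (j + 1)" using n comb zeq
      by (intro empty_sector[OF z(1) z0 _ zeq]) auto
    with z1 show False by simp
  qed
  define s t where "s = 1 / (l + q)" and "t = l / (l + q)"
  have st: "0 < s" "s < 1" "0 < t" "t < 1" using lq comb by (auto simp: s_def t_def)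
  have s: "s * (l + q) = 1" "1 - t = s * q" using comb by (auto simp: s_def t_def field_simps)
  have o: "(1 - s) *\<^sub>R y j + s *\<^sub>R z = (1 - t) *\<^sub>R y (j + 1) + t *\<^sub>R 0"
  proof -
    have "(1 - s) *\<^sub>R y j + s *\<^sub>R z = (1 - s * (l + q)) *\<^sub>R y j + (s * q) *\<^sub>R y (j + 1)"
      unfolding zeq by (simp add: algebra_simps)
    then show ?thesis unfolding s by simp
  qed
  have sides: "1 - \<alpha> \<le> cmod (y j - y (j + 1))" "1 - \<alpha> \<le> cmod (y (j + 1) - z)"
    "1 - \<alpha> \<le> cmod (z - 0)" "1 - \<alpha> \<le> cmod (0 - y j)"
    using separated[of "y j" "y (j + 1)"] separated[of "y (j + 1)" z] separated[of z 0]
      y_props y_distinct[of j "j + 1"] z z0 z1 zero_in by (auto intro: less_imp_le)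
  have diags: "cmod (y j - z) \<le> sqrt 2 + \<alpha>" "cmod (y (j + 1) - 0) \<le> sqrt 2 + \<alpha>"
    using z(3) y_props(3)[of "j + 1"] by (auto simp: norm_minus_commute)
  have z2: "(cmod z)\<^sup>2 \<le> 1 + 13 * \<alpha>"
    using crossing_estimates(3)[OF alpha sides diags st o] by simp
  have "cmod z \<le> 7/5"
  proof (rule power2_le_imp_le)
    show "(cmod z)\<^sup>2 \<le> (7/5)\<^sup>2" using z2 alpha by (simp add: power2_eq_square)
  qed simp
  then have zR: "cmod z < sqrt 2 + \<alpha>" using sqrt2_bounds alpha by simp
  obtain k where k: "j \<le> k" "k < j + 8" "z = y k" using neighbor_index[OF z(1) z0 zR] .
  have "0 < cross (y j) (y k)" using cz c comb k(3) by simp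
  then have "0 < sin (\<theta> k - \<theta> j)" unfolding cross_y_sgn .
  moreover have "\<theta> j \<le> \<theta> k" using direction_less[of j k] k(1) by (cases "j = k") auto
  ultimately have kp: "\<theta> k - \<theta> j < pi" "0 \<le> \<theta> k - \<theta> j"
    using sin_pos_imp[of "\<theta> k - \<theta> j"] direction_less[OF k(2)] th_period[of j] by auto
  have "k < j + 3"
  proof (rule ccontr)
    assume "\<not> k < j + 3"
    then have "\<theta> (j + 3) \<le> \<theta> k" using direction_less[of "j + 3" k] by (cases "k = j + 3") auto
    then have "\<theta> j + (715/1000) * 3 \<le> \<theta> k" using direction_gap[of j "j + 3"] by simp
    then have "0 \<le> pi - (\<theta> k - \<theta> j)" "pi - (\<theta> k - \<theta> j) \<le> 1" using kp pi_approx by auto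
    then have "cos 1 \<le> cos (pi - (\<theta> k - \<theta> j))" using pi_approx by (intro cos_monotone_0_pi_le) auto
    then have "cos (\<theta> k - \<theta> j) \<le> - cos 1" by simp
    moreover have "1/2 \<le> cos (1::real)" by (rule order_trans[OF _ cos_lower_bound]) simp
    ultimately have "cos (\<theta> k - \<theta> j) \<le> - (1/2)" by simp
    moreover have "998/1000 \<le> cmod (y j) * cmod (y k)"
      using mult_mono[of "999/1000" "cmod (y j)" "999/1000" "cmod (y k)"] y_props(5) by simp
    ultimately have "(cmod (y j) * cmod (y k)) * cos (\<theta> k - \<theta> j) \<le> (cmod (y j) * cmod (y k)) * (- (1/2))"
      by (intro mult_left_mono) auto
    then have "y j \<bullet> z \<le> - (499/1000)" using \<open>998/1000 \<le> _\<close> unfolding k(3) inner_y by simp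
    moreover have "1 - 2 * \<alpha> \<le> (cmod (y j))\<^sup>2" "1 - 2 * \<alpha> \<le> (cmod z)\<^sup>2"
      using square_norm_lower sides by auto
    moreover have "(cmod (y j - z))\<^sup>2 \<le> 2 + 3 * \<alpha>" using edge_square_norm[OF z(3)] by (simp add: norm_minus_commute)
    ultimately show False using norm_diff_sq[of "y j" z] alpha by linarith
  qed
  moreover have "k \<noteq> j" "k \<noteq> j + 1" using z(2) z1 k(3) by auto
  ultimately have k2: "z = y (j + 2)" using k by (cases "k = j + 2") auto
  have "q *\<^sub>R y (j + 1) = (l + q - 1) *\<^sub>R y j + z"
    unfolding zeq by (simp add: algebra_simps)
  then have "(1 / q) *\<^sub>R (q *\<^sub>R y (j + 1)) = (1 / q) *\<^sub>R ((l + q - 1) *\<^sub>R y j + z)" by simp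
  then have "y (j + 1) = ((l + q - 1) / q) *\<^sub>R y j + (1 / q) *\<^sub>R z"
    using comb(3) by (simp add: scaleR_add_right)
  moreover have "0 < (l + q - 1) / q" "0 < 1 / q" "1 < (l + q - 1) / q + 1 / q"
    using lq comb by (auto simp: field_simps)
  ultimately have "\<exists>a b. 0 < a \<and> 0 < b \<and> 1 < a + b \<and> y (j + 1) = a *\<^sub>R y j + b *\<^sub>R y (j + 2)"
    unfolding k2 by blast
  moreover have ix: "j + 1 + 1 = j + 2" "j + 1 - 1 = j" by simp_all
  ultimately have "crossed (j + 1)" unfolding crossed_def ix using z(3) k2 by simp
  with k2 show ?thesis by simp
qed

text \<open>
  Complex conjugation reverses the orientation; it turns statements about \<open>y (j + 1)\<close> into statements about
  \<open>y (j - 1)\<close>.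
\<close>

lemma mirror: "octet \<alpha> (cnj ` S) (\<lambda>i. cnj (y (- i))) (\<lambda>i. - \<theta> (- i))"
proof
  show "0 < \<alpha>" "\<alpha> \<le> 1/1000" by (rule alpha)+
  show "1 - \<alpha> < cmod (x - z)" if "x \<in> cnj ` S" "z \<in> cnj ` S" "x \<noteq> z" for x z
    using that separated by (auto simp flip: complex_cnj_diff)
  show "0 \<in> cnj ` S" using zero_in by (force simp: image_iff)
  show "{z \<in> cnj ` S. z \<noteq> 0 \<and> cmod z < sqrt 2 + \<alpha>} = range (\<lambda>i. cnj (y (- i)))"
  proof -
    have "{z \<in> cnj ` S. z \<noteq> 0 \<and> cmod z < sqrt 2 + \<alpha>} = cnj ` {z \<in> S. z \<noteq> 0 \<and> cmod z < sqrt 2 + \<alpha>}"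
      by auto
    also have "\<dots> = range (\<lambda>i. cnj (y (- i)))" unfolding ring
      by (auto simp: image_iff) (metis minus_minus)
    finally show ?thesis .
  qed
  fix i
  show "cnj (y (- (i + 8))) = cnj (y (- i))" using y_period[of "- (i + 8)"] by simp
  show "- \<theta> (- (i + 8)) = - \<theta> (- i) + 2 * pi" using th_period[of "- (i + 8)"] by simp
  have "cnj (rcis r t) = rcis r (- t)" for r t by (simp add: complex_eq_iff)
  then show "cnj (y (- i)) = rcis (cmod (cnj (y (- i)))) (- \<theta> (- i))"
    using polar[of "- i"] by (metis complex_mod_cnj)
  show "strict_mono (\<lambda>i. - \<theta> (- i))" by (auto intro!: strict_monoI direction_less)
  have "{z \<in> cnj ` S. z \<noteq> cnj (y (- i)) \<and> cmod (z - cnj (y (- i))) < sqrt 2 + \<alpha>}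
      = cnj ` {z \<in> S. z \<noteq> y (- i) \<and> cmod (z - y (- i)) < sqrt 2 + \<alpha>}"
    by (auto simp flip: complex_cnj_diff)
  then show "card {z \<in> cnj ` S. z \<noteq> cnj (y (- i)) \<and> cmod (z - cnj (y (- i))) < sqrt 2 + \<alpha>} = 8"
    using degree[of "- i"] by (simp add: card_image inj_on_def)
qed

lemma inner_neighbor_backward:
  assumes z: "z \<in> S" "z \<noteq> y j" "cmod (z - y j) < sqrt 2 + \<alpha>"
    and comb: "z - y j = l *\<^sub>R (- y j) + q *\<^sub>R (y (j - 1) - y j)" "0 < l" "0 < q"
  shows "z = y (j - 2) \<and> crossed (j - 1)"
proof -
  interpret m: octet \<alpha> "cnj ` S" "\<lambda>i. cnj (y (- i))" "\<lambda>i. - \<theta> (- i)" by (rule mirror)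
  have crm: "m.crossed (- (j - 1)) \<longleftrightarrow> crossed (j - 1)"
  proof -
    have e: "- (- (j - 1) + 1) = j - 1 - 1" "- (- (j - 1) - 1) = j - 1 + 1" "- (- (j - 1)) = j - 1" by simp_all
    have eq: "(cnj (y (j - 1)) = a *\<^sub>R cnj (y (j - 1 + 1)) + b *\<^sub>R cnj (y (j - 1 - 1)))
        \<longleftrightarrow> (y (j - 1) = b *\<^sub>R y (j - 1 - 1) + a *\<^sub>R y (j - 1 + 1))" for a b
      by (auto simp: complex_eq_iff)
    show ?thesis
      unfolding m.crossed_def crossed_def e complex_cnj_diff[symmetric] complex_mod_cnj eq
      using norm_minus_commute[of "y (j - 1 - 1)" "y (j - 1 + 1)"] add.commute[where 'a=real]
      by metis
  qed
  have "cnj z = cnj (y (- (- j + 2))) \<and> m.crossed (- j + 1)"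
  proof (rule m.inner_neighbor_forward)
    show "cnj z \<in> cnj ` S" "cnj z \<noteq> cnj (y (- (- j)))" using z by auto
    show "cmod (cnj z - cnj (y (- (- j)))) < sqrt 2 + \<alpha>"
      unfolding complex_cnj_diff[symmetric] complex_mod_cnj using z by simp
    have "cnj (z - y j) = cnj (l *\<^sub>R (- y j) + q *\<^sub>R (y (j - 1) - y j))" using comb(1) by simp
    then show "cnj z - cnj (y (- (- j))) = l *\<^sub>R (- cnj (y (- (- j)))) + q *\<^sub>R (cnj (y (- (- j + 1))) - cnj (y (- (- j))))"
      by (simp add: complex_eq_iff)
  qed (use comb in auto)
  then show ?thesis using crm by simp
qed

section \<open>Counting directions in the outer sectors\<close>

text \<open>
  The direction of the octagon side from \<open>y i\<close> to \<open>y (i + 1)\<close>, with the branch of the argument chosen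
  so that it continues the angles \<open>\<theta>\<close>.
\<close>

definition \<psi> :: "int \<Rightarrow> real"
  where "\<psi> i = \<theta> i + Arg2pi ((y (i + 1) - y i) * cis (- \<theta> i))"

lemma \<psi>_polar: "y (i + 1) - y i = rcis (cmod (y (i + 1) - y i)) (\<psi> i)"
  unfolding \<psi>_def by (rule rcis_Arg2pi)

lemma \<psi>_period: "\<psi> (i + 8) = \<psi> i + 2 * pi"
proof -
  have "cis (- \<theta> (i + 8)) = cis (- \<theta> i)"
    unfolding th_period by (simp add: complex_eq_iff cos_add sin_add cos_diff sin_diff)
  moreover have "y (i + 8 + 1) = y (i + 1)" using y_period[of "i + 1"] by (simp add: algebra_simps)
  ultimately show ?thesis unfolding \<psi>_def by (simp add: y_period th_period)
qed

text \<open>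
  Both bounds say that the triangle \<open>0\<close>, \<open>y i\<close>, \<open>y (i + 1)\<close> is positively oriented.
\<close>

lemma \<psi>_bounds: "\<theta> (i + 1) < \<psi> i" "\<psi> i < \<theta> i + pi" "0 < cmod (y (i + 1) - y i)"
proof -
  show d: "0 < cmod (y (i + 1) - y i)" using y_distinct[of i "i + 1"] by simp
  have c: "0 < cross (y i) (y (i + 1))" by (rule cross_next) auto
  have e: "Im (v * cis (- \<theta> i)) * cmod (y i) = cross (y i) v" for v
    by (subst polar[of i]) (simp add: cross_def algebra_simps)
  have "0 < Im ((y (i + 1) - y i) * cis (- \<theta> i)) * cmod (y i)"
    unfolding e using c by simp
  then have "0 < Im ((y (i + 1) - y i) * cis (- \<theta> i))"
    using y_props(2)[of i] by (simp add: zero_less_mult_iff)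
  then have b: "\<theta> i < \<psi> i" "\<psi> i < \<theta> i + pi"
    unfolding \<psi>_def Arg2pi_lt_pi[symmetric] by auto
  then show "\<psi> i < \<theta> i + pi" by simp
  have "0 < cross (y (i + 1)) (y (i + 1) - y i)" using c by (simp add: cross_def algebra_simps)
  then have "0 < (cmod (y (i + 1)) * cmod (y (i + 1) - y i)) * sin (\<psi> i - \<theta> (i + 1))"
    by (subst (asm) polar[of "i + 1"], subst (asm) \<psi>_polar) (simp only: cross_rcis)
  then have s: "0 < sin (\<psi> i - \<theta> (i + 1))"
    by (rule zero_less_mult_pos) (use y_props(2)[of "i + 1"] d in simp)
  show "\<theta> (i + 1) < \<psi> i"
  proof (rule ccontr)
    assume n: "\<not> \<theta> (i + 1) < \<psi> i"
    have "0 \<le> sin (\<theta> (i + 1) - \<psi> i)"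
      using n b direction_two_steps[of 1 i] pi_approx by (intro sin_ge_zero) auto
    then show False using s sin_minus[of "\<psi> i - \<theta> (i + 1)"] by simp
  qed
qed

text \<open>
  Seen from \<open>y j\<close>, the previous corner \<open>y (j - 1)\<close> has direction \<open>\<psi> (j - 1) + \<pi>\<close> and the next corner
  direction \<open>\<psi> j + 2 \<pi>\<close>; between them lies the closed outer sector, of size \<open>\<pi> + \<psi> j - \<psi> (j - 1)\<close>.
  Of the eight neighbors of \<open>y j\<close>, at most the origin and one for each crossed adjacent index lie
  strictly inside the octagon angle. The others have directions in the outer sector that are \<open>0.715\<close>
  apart, and \<open>n\<close> such directions use up \<open>n - 1\<close> gaps.
\<close>

lemma outer_sector:
  "(6 - of_bool (crossed (j + 1)) - of_bool (crossed (j - 1))) * (715/1000) \<le> pi + \<psi> j - \<psi> (j - 1)"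
proof -
  define N where "N = {z \<in> S. z \<noteq> y j \<and> cmod (z - y j) < sqrt 2 + \<alpha>}"
  define b where "b = \<psi> (j - 1) + pi"
  define t where "t = (\<lambda>z. b + Arg2pi ((z - y j) * cis (- b)))"
  \<comment> \<open>\<open>I\<close> collects the neighbors strictly inside the octagon angle; they all lie in \<open>E\<close>\<close>
  define I where "I = {z \<in> N. \<psi> j + 2 * pi < t z}"
  define E where "E = {0} \<union> (if crossed (j + 1) then {y (j + 2)} else {})
      \<union> (if crossed (j - 1) then {y (j - 2)} else {})"
  have N: "card N = 8" unfolding N_def by (rule degree)
  then have fin: "finite N" by (simp add: card_ge_0_finite)
  have tp: "z - y j = rcis (cmod (z - y j)) (t z)" for z
    unfolding t_def by (rule rcis_Arg2pi)
  have tb: "b \<le> t z" "t z < b + 2 * pi" for z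
    using Arg2pi[of "(z - y j) * cis (- b)"] by (auto simp: t_def)
  have Nb: "999/1000 \<le> cmod (z - y j)" "cmod (z - y j) \<le> 14153/10000" if "z \<in> N" for z
    using that separated_rat[of z "y j"] y_props(1) edge_bound by (auto simp: N_def)
  have sep: "715/1000 \<le> t z - t x" if "x \<in> N" "z \<in> N" "x \<noteq> z" "t x \<le> t z" for x z
  proof (rule direction_separation[OF Nb[OF that(1)] Nb[OF that(2)] _ that(4)])
    show "999/1000 \<le> cmod (rcis (cmod (x - y j)) (t x) - rcis (cmod (z - y j)) (t z))"
      unfolding tp[symmetric] using that separated_rat[of x z] by (simp add: N_def)
  qed
  have inj: "inj_on t N"
  proof (rule inj_onI, rule ccontr)
    fix x z assume "x \<in> N" "z \<in> N" "t x = t z" "x \<noteq> z"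
    then show False using sep[of x z] by simp
  qed
  \<comment> \<open>the directions of \<open>y (j - 1)\<close>, the origin and \<open>y (j + 1)\<close> from \<open>y j\<close>, in the turn that starts at \<open>b\<close>\<close>
  have jm: "y j - y (j - 1) = rcis (cmod (y (j - 1) - y j)) (\<psi> (j - 1))" "\<psi> (j - 1) < \<theta> (j - 1) + pi" "\<theta> j < \<psi> (j - 1)"
    using \<psi>_polar[of "j - 1"] \<psi>_bounds[of "j - 1"] by (simp_all add: norm_minus_commute)
  have prev: "y (j - 1) - y j = rcis (cmod (y (j - 1) - y j)) (\<psi> (j - 1) + 3 * pi)"
    unfolding rcis_add_3pi jm(1)[symmetric] by simp
  have cen: "- y j = rcis (cmod (y j)) (\<theta> j + 3 * pi)"
    unfolding rcis_add_3pi polar[symmetric] by simp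
  have nxt: "y (j + 1) - y j = rcis (cmod (y (j + 1) - y j)) (\<psi> j + 2 * pi)"
    unfolding rcis_add_2pi by (rule \<psi>_polar)
  have dpos: "0 < cmod (y (j - 1) - y j)" "0 < cmod (y j)" "0 < cmod (y (j + 1) - y j)"
    using y_distinct[of "j - 1" j] y_distinct[of j "j + 1"] y_props(2) by auto
  have th1: "\<theta> (j - 1) < \<theta> j" "\<theta> j < \<theta> (j + 1)" by (auto intro: direction_less)
  have "I \<subseteq> E"
  proof
    fix z assume z: "z \<in> I"
    then have zN: "z \<in> N" and zt: "\<psi> j + 2 * pi < t z" by (auto simp: I_def)
    then have zS: "z \<in> S" "z \<noteq> y j" "cmod (z - y j) < sqrt 2 + \<alpha>" by (auto simp: N_def)
    have zp: "0 < cmod (z - y j)" using zS by simp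
    consider "t z < \<theta> j + 3 * pi" | "t z = \<theta> j + 3 * pi" | "\<theta> j + 3 * pi < t z" by linarith
    then show "z \<in> E"
    proof cases
      case 1
      obtain q l where "0 < q" "0 < l" "rcis (cmod (z - y j)) (t z)
          = q *\<^sub>R rcis (cmod (y (j + 1) - y j)) (\<psi> j + 2 * pi) + l *\<^sub>R rcis (cmod (y j)) (\<theta> j + 3 * pi)"
        by (rule rcis_between[OF zt 1 _ dpos(3,2) zp]) (use \<psi>_bounds(1)[of j] th1 in auto)
      then have "z = y (j + 2) \<and> crossed (j + 1)"
        unfolding nxt[symmetric] cen[symmetric] tp[symmetric]
        by (intro inner_neighbor_forward[OF zS, of l q]) (auto simp: add.commute)
      then show ?thesis by (simp add: E_def)
    next
      case 2
      have "z = 0"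
      proof (rule ccontr)
        assume "z \<noteq> 0"
        then have "999/1000 \<le> cmod ((z - y j) - (- y j))" using separated_rat[OF zS(1) zero_in] by simp
        then have "999/1000 \<le> cmod (rcis (cmod (z - y j)) (t z) - rcis (cmod (y j)) (\<theta> j + 3 * pi))"
          unfolding tp[symmetric] cen[symmetric] .
        then have "715/1000 \<le> \<theta> j + 3 * pi - t z"
          by (rule direction_separation[OF Nb[OF zN] y_props(5,6)]) (use 2 in simp)
        then show False using 2 by simp
      qed
      then show ?thesis by (simp add: E_def)
    next
      case 3
      have "t z < \<psi> (j - 1) + 3 * pi" using tb(2)[of z] by (simp add: b_def)
      then obtain l q where "0 < l" "0 < q" "rcis (cmod (z - y j)) (t z)
          = l *\<^sub>R rcis (cmod (y j)) (\<theta> j + 3 * pi) + q *\<^sub>R rcis (cmod (y (j - 1) - y j)) (\<psi> (j - 1) + 3 * pi)"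
        by (rule rcis_between[OF 3 _ _ dpos(2,1) zp]) (use jm(2) th1 in auto)
      then have "z = y (j - 2) \<and> crossed (j - 1)"
        unfolding prev[symmetric] cen[symmetric] tp[symmetric]
        by (intro inner_neighbor_backward[OF zS, of l q]) auto
      then show ?thesis by (simp add: E_def)
    qed
  qed
  moreover have "finite E" by (simp add: E_def)
  ultimately have "card I \<le> card E" by (rule card_mono[rotated])
  also have "card E \<le> 1 + of_bool (crossed (j + 1)) + of_bool (crossed (j - 1))"
    by (auto simp: E_def card_insert_if)
  finally have cI: "card I \<le> 1 + of_bool (crossed (j + 1)) + of_bool (crossed (j - 1))" .
  have "card (N - I) = 8 - card I" "card I \<le> 8"
    using N fin card_Diff_subset[of I N] card_mono[of N I] by (auto simp: I_def)
  then have cO: "6 - of_bool (crossed (j + 1)) - of_bool (crossed (j - 1)) \<le> real (card (N - I)) - 1"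
    using cI by (auto simp: of_nat_diff split: if_splits)
  have "(real (card (t ` (N - I))) - 1) * (715/1000) \<le> (\<psi> j + 2 * pi) - b"
  proof (rule card_separated_in_interval)
    show "finite (t ` (N - I))" using fin by simp
    show "t ` (N - I) \<subseteq> {b..\<psi> j + 2 * pi}" using tb by (auto simp: I_def not_less)
    show "715/1000 \<le> v - u" if uv: "u \<in> t ` (N - I)" "v \<in> t ` (N - I)" "u < v" for u v
    proof -
      obtain x z where "u = t x" "v = t z" "x \<in> N" "z \<in> N" using uv by auto
      then show ?thesis using sep[of x z] uv(3) by auto
    qed
    show "b \<le> \<psi> j + 2 * pi + 715/1000" using jm \<psi>_bounds(1)[of j] th1 by (simp add: b_def)
  qed
  moreover have "card (t ` (N - I)) = card (N - I)"
    by (rule card_image) (rule inj_on_subset[OF inj], auto)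
  moreover have "(6 - of_bool (crossed (j + 1)) - of_bool (crossed (j - 1))) * (715/1000)
      \<le> (real (card (N - I)) - 1) * (715/1000)"
    using cO by (intro mult_right_mono) auto
  ultimately show ?thesis by (simp add: b_def)
qed

section \<open>Four alternating squares\<close>

lemma product_of_lengths:
  assumes "999/1000 \<le> r" "999/1000 \<le> s"
  shows "998/1000 \<le> r * (s::real)"
proof -
  have "(999/1000) * (999/1000) \<le> r * s" using assms by (intro mult_mono) auto
  then show ?thesis by simp
qed

text \<open>
  The threshold \<open>1.55\<close> lies just below \<open>\<pi>/2\<close>; its cosine is about \<open>0.0208\<close>, while the inner
  products in an almost unit square are at most \<open>19 \<alpha> \<le> 0.019\<close>.
\<close>

lemma almost_right_angle:
  assumes "999/1000 \<le> r" "999/1000 \<le> s" "r * s * cos x \<le> 19 * \<alpha>" "0 \<le> x"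
  shows "155/100 \<le> x"
proof (rule ccontr)
  assume n: "\<not> 155/100 \<le> x"
  have "199/10000 \<le> cos (155/100 :: real)" by (rule order_trans[OF _ cos_lower_bound]) (simp add: eval_nat_numeral)
  also have "\<dots> \<le> cos x" using n assms(4) pi_approx by (intro cos_monotone_0_pi_le) auto
  finally have "(998/1000) * (199/10000) \<le> r * s * cos x"
    using product_of_lengths[OF assms(1,2)] by (intro mult_mono) auto
  then show False using assms(3) alpha by simp
qed

lemma crossed_angle:
  assumes "crossed m"
  shows "\<theta> (m - 1) + 155/100 \<le> \<theta> (m + 1)"
proof -
  have "155/100 \<le> \<theta> (m + 1) - \<theta> (m - 1)"
    using crossed_square(5)[OF assms] direction_less[of "m - 1" "m + 1"]
    by (intro almost_right_angle[OF y_props(5) y_props(5)]) (auto simp: inner_y abs_le_iff)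
  then show ?thesis by simp
qed

lemma crossed_not_adjacent: "crossed m \<Longrightarrow> \<not> crossed (m + 1)"
  using crossed_square(3)[of m] crossed_square(1)[of "m + 1"] alpha by auto

lemma short_pair_angle:
  assumes "(cmod (y i))\<^sup>2 \<le> 1 + 13 * \<alpha>" "(cmod (y (i + 1)))\<^sup>2 \<le> 1 + 13 * \<alpha>"
  shows "\<theta> i + 1 \<le> \<theta> (i + 1)"
proof (rule ccontr)
  assume n: "\<not> \<theta> i + 1 \<le> \<theta> (i + 1)"
  have "54/100 \<le> cos (1::real)" by (rule order_trans[OF _ cos_lower_bound]) simp
  also have "\<dots> \<le> cos (\<theta> (i + 1) - \<theta> i)"
    using n direction_less[of i "i + 1"] pi_approx by (intro cos_monotone_0_pi_le) auto
  finally have "(998/1000) * (54/100) \<le> y i \<bullet> y (i + 1)"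
    unfolding inner_y using product_of_lengths[OF y_props(5) y_props(5)] by (intro mult_mono) auto
  moreover have "1 - 2 * \<alpha> \<le> (cmod (y i - y (i + 1)))\<^sup>2"
    using separated[of "y i" "y (i + 1)"] y_props(1) y_distinct[of i "i + 1"]
    by (intro square_norm_lower) (auto intro: less_imp_le)
  ultimately show False using assms norm_diff_sq[of "y i" "y (i + 1)"] alpha by simp
qed

text \<open>
  Summing \<open>outer_sector\<close> over a period, the differences of \<open>\<psi>\<close> telescope to \<open>2 \<pi>\<close> and every crossed
  index is counted at both of its neighbors.
\<close>

lemma at_least_three_crossed:
  "2 < of_bool (crossed 0) + of_bool (crossed 1) + of_bool (crossed 2) + of_bool (crossed 3)
     + of_bool (crossed 4) + of_bool (crossed 5) + of_bool (crossed 6) + (of_bool (crossed 7) :: real)"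
proof -
  define c :: "int \<Rightarrow> real" where "c i = of_bool (crossed i)" for i
  have o: "(6 - c (j + 1) - c (j - 1)) * (715/1000) \<le> pi + \<psi> j - \<psi> (j - 1)" for j
    using outer_sector[of j] by (simp add: c_def)
  have per: "c (- 1) = c 7" "c 8 = c 0" "\<psi> (- 1) = \<psi> 7 - 2 * pi"
    using crossed_period[of "-1" 1] crossed_period[of 0 1] \<psi>_period[of "-1"] by (simp_all add: c_def)
  have "48 * (715/1000) - 2 * (715/1000) * (c 0 + c 1 + c 2 + c 3 + c 4 + c 5 + c 6 + c 7) \<le> 10 * pi"
    using o[of 0] o[of 1] o[of 2] o[of 3] o[of 4] o[of 5] o[of 6] o[of 7]
    unfolding left_diff_distrib distrib_left by (simp add: per add_divide_distrib)
  moreover have "2 < T" if "48 * (715/1000) - 2 * (715/1000) * T \<le> 10 * pi" for T :: real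
    using that pi_approx by simp
  ultimately have "2 < c 0 + c 1 + c 2 + c 3 + c 4 + c 5 + c 6 + c 7" by blast
  then show ?thesis by (simp add: c_def)
qed

lemma crossed_pattern:
  obtains m where "crossed m" "crossed (m + 2)" "crossed (m + 4) \<or> crossed (m + 5)"
proof -
  have p: "crossed 8 = crossed 0" "crossed 9 = crossed 1" "crossed 10 = crossed 2"
     "crossed 11 = crossed 3" "crossed 12 = crossed 4"
    using crossed_period[of 0 1] crossed_period[of 1 1] crossed_period[of 2 1] crossed_period[of 3 1]
      crossed_period[of 4 1] by simp_all
  have n: "\<not> (crossed 0 \<and> crossed 1)" "\<not> (crossed 1 \<and> crossed 2)" "\<not> (crossed 2 \<and> crossed 3)"
    "\<not> (crossed 3 \<and> crossed 4)" "\<not> (crossed 4 \<and> crossed 5)" "\<not> (crossed 5 \<and> crossed 6)"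
    "\<not> (crossed 6 \<and> crossed 7)" "\<not> (crossed 7 \<and> crossed 0)"
    using crossed_not_adjacent[of 0] crossed_not_adjacent[of 1] crossed_not_adjacent[of 2]
     crossed_not_adjacent[of 3] crossed_not_adjacent[of 4] crossed_not_adjacent[of 5]
     crossed_not_adjacent[of 6] crossed_not_adjacent[of 7] p by auto
  have "\<exists>m \<in> {0, 1, 2, 3, 4, 5, 6, 7}. crossed m \<and> crossed (m + 2) \<and> (crossed (m + 4) \<or> crossed (m + 5))"
    using at_least_three_crossed n by (simp add: p) (auto simp: of_bool_def split: if_splits)
  then show thesis using that by auto
qed

text \<open>
  Three crossed indices at cyclic distances \<open>2, 3, 3\<close> account for three almost right angles
  at the origin, and the two remaining gaps join spokes of length about \<open>1\<close>, so they are at least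
  \<open>1\<close>. The total \<open>3 * 1.55 + 2\<close> exceeds \<open>2 \<pi>\<close>.
\<close>

lemma not_crossed_2_3_3:
  assumes "crossed m" "crossed (m + 2)"
  shows "\<not> crossed (m + 5)"
proof
  assume c: "crossed (m + 5)"
  have i: "m + 2 - 1 = m + 1" "m + 2 + 1 = m + 3" "m + 5 - 1 = m + 4" "m + 5 + 1 = m + 6"
    "m + 3 + 1 = m + 4" "m + 6 + 1 = m + 7" by simp_all
  have e: "y (m + 7) = y (m - 1)" "\<theta> (m + 7) = \<theta> (m - 1) + 2 * pi"
    using y_period[of "m - 1"] th_period[of "m - 1"] by (simp_all add: algebra_simps)
  have "\<theta> (m + 3) + 1 \<le> \<theta> (m + 4)"
    using short_pair_angle[of "m + 3"] crossed_square(2)[OF assms(2)] crossed_square(1)[OF c] by (simp only: i)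
  moreover have "\<theta> (m + 6) + 1 \<le> \<theta> (m + 7)"
    using short_pair_angle[of "m + 6"] crossed_square(2)[OF c] crossed_square(1)[OF assms(1)] by (simp only: i e)
  moreover have "\<theta> (m - 1) + 155/100 \<le> \<theta> (m + 1)" "\<theta> (m + 1) + 155/100 \<le> \<theta> (m + 3)"
    "\<theta> (m + 4) + 155/100 \<le> \<theta> (m + 6)"
    using crossed_angle[OF assms(1)] crossed_angle[OF assms(2)] crossed_angle[OF c] by (simp_all only: i)
  ultimately show False using pi_approx unfolding e by simp
qed

text \<open>
  In the almost unit square at a crossed index, the octagon side that leaves \<open>y m\<close> is almost orthogonal to the
  spoke at its end; \<open>edge_angle_prev\<close> is the same for the side that arrives at \<open>y m\<close> and the
  spoke at its start.
\<close>

lemma edge_angle_next: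
  assumes "crossed m"
  shows "\<theta> (m + 1) + 155/100 \<le> \<psi> m"
proof -
  have d: "999/1000 \<le> cmod (y (m + 1) - y m)"
    using separated_rat[of "y (m + 1)" "y m"] y_props(1) y_distinct[of m "m + 1"] by auto
  have "(y (m + 1) - y m) \<bullet> y (m + 1) = y (m + 1) \<bullet> (y (m + 1) - y m)" by (rule inner_commute)
  also have "\<dots> = cmod (y (m + 1)) * cmod (y (m + 1) - y m) * cos (\<psi> m - \<theta> (m + 1))"
    by (subst polar[of "m + 1"], subst \<psi>_polar) (rule inner_rcis)
  finally have e: "(y m - y (m + 1)) \<bullet> y (m + 1) = - (cmod (y (m + 1)) * cmod (y (m + 1) - y m) * cos (\<psi> m - \<theta> (m + 1)))"
    by (simp add: inner_diff_left)
  have "155/100 \<le> \<psi> m - \<theta> (m + 1)"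
    using crossed_square(7)[OF assms] \<psi>_bounds(1)[of m] unfolding e
    by (intro almost_right_angle[OF y_props(5)[of "m + 1"] d]) auto
  then show ?thesis by simp
qed

lemma edge_angle_prev:
  assumes "crossed m"
  shows "\<psi> (m - 1) + 155/100 \<le> \<theta> (m - 1) + pi"
proof -
  have d: "999/1000 \<le> cmod (y m - y (m - 1))"
    using separated_rat[of "y m" "y (m - 1)"] y_props(1) y_distinct[of "m - 1" m] by auto
  have p: "y m - y (m - 1) = rcis (cmod (y m - y (m - 1))) (\<psi> (m - 1))"
    using \<psi>_polar[of "m - 1"] by simp
  have "(y m - y (m - 1)) \<bullet> y (m - 1) = y (m - 1) \<bullet> (y m - y (m - 1))" by (rule inner_commute)
  also have "\<dots> = cmod (y (m - 1)) * cmod (y m - y (m - 1)) * cos (\<psi> (m - 1) - \<theta> (m - 1))"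
    by (subst polar[of "m - 1"], subst p) (rule inner_rcis)
  also have "cos (\<psi> (m - 1) - \<theta> (m - 1)) = - cos (pi - (\<psi> (m - 1) - \<theta> (m - 1)))" by simp
  finally have e: "(y m - y (m - 1)) \<bullet> y (m - 1)
     = - (cmod (y (m - 1)) * cmod (y m - y (m - 1)) * cos (pi - (\<psi> (m - 1) - \<theta> (m - 1))))" by simp
  have "155/100 \<le> pi - (\<psi> (m - 1) - \<theta> (m - 1))"
    using crossed_square(6)[OF assms] \<psi>_bounds(2)[of "m - 1"] unfolding e
    by (intro almost_right_angle[OF y_props(5)[of "m - 1"] d]) auto
  then show ?thesis by simp
qed

text \<open>
  The three squares turn the side direction by almost three right angles, from \<open>\<psi> (m - 1)\<close> to
  \<open>\<psi> (m + 4)\<close>. This leaves at most \<open>6 \<pi> - 7.75\<close> for the outer sectors at \<open>m + 5\<close>,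
  \<open>m + 6\<close> and \<open>m + 7\<close>, whereas without a crossing at \<open>m + 6\<close> they need \<open>5 + 6 + 5\<close> gaps.
\<close>

lemma fourth_crossed:
  assumes "crossed m" "crossed (m + 2)" "crossed (m + 4)"
  shows "crossed (m + 6)"
proof (rule ccontr)
  assume n: "\<not> crossed (m + 6)"
  have i: "m + 2 - 1 = m + 1" "m + 2 + 1 = m + 3" "m + 4 - 1 = m + 3" "m + 4 + 1 = m + 5"
    "m + 5 + 1 = m + 6" "m + 5 - 1 = m + 4" "m + 6 + 1 = m + 7" "m + 6 - 1 = m + 5"
    "m + 7 + 1 = m + 8" "m + 7 - 1 = m + 6" by simp_all
  have c8: "crossed (m + 8)" using crossed_period[of m 1] assms by simp
  have "\<not> crossed (m + 5)" using crossed_not_adjacent[OF assms(3)] unfolding i .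
  moreover have "\<not> crossed (m + 7)" using crossed_not_adjacent[of "m + 7"] c8 unfolding i by blast
  ultimately have "5 * (715/1000) \<le> pi + \<psi> (m + 5) - \<psi> (m + 4)"
    "6 * (715/1000) \<le> pi + \<psi> (m + 6) - \<psi> (m + 5)" "5 * (715/1000) \<le> pi + \<psi> (m + 7) - \<psi> (m + 6)"
    using outer_sector[of "m + 5"] outer_sector[of "m + 6"] outer_sector[of "m + 7"] n c8 assms(3)
    unfolding i by simp_all
  moreover have "\<psi> (m + 7) = \<psi> (m - 1) + 2 * pi" using \<psi>_period[of "m - 1"] by (simp add: algebra_simps)
  moreover have "\<theta> (m + 5) + 155/100 \<le> \<psi> (m + 4)" using edge_angle_next[OF assms(3)] by (simp only: i)
  moreover have "\<psi> (m - 1) + 155/100 \<le> \<theta> (m - 1) + pi" by (rule edge_angle_prev[OF assms(1)])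
  moreover have "\<theta> (m - 1) + 155/100 \<le> \<theta> (m + 1)" "\<theta> (m + 1) + 155/100 \<le> \<theta> (m + 3)"
    "\<theta> (m + 3) + 155/100 \<le> \<theta> (m + 5)"
    using crossed_angle[OF assms(1)] crossed_angle[OF assms(2)] crossed_angle[OF assms(3)] by (simp_all only: i)
  ultimately show False using pi_approx by simp
qed

text \<open>
  The minimality of \<open>y 0\<close> decides the parity: crossed spokes are about \<open>sqrt 2\<close> long, so \<open>0\<close> is not crossed.
\<close>

lemma alternately_crossed:
  assumes "\<And>i. cmod (y 0) \<le> cmod (y i)"
  shows "crossed 1" "crossed 3" "crossed 5" "crossed 7"
proof -
  obtain m where m: "crossed m" "crossed (m + 2)" "crossed (m + 4)" "crossed (m + 6)"
    using crossed_pattern not_crossed_2_3_3 fourth_crossed by metis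
  have parity: "crossed i" if e: "even (i - m)" for i
  proof -
    obtain n where n: "i - m = 2 * n" using e unfolding dvd_def by blast
    have "n mod 4 \<in> {0, 1, 2, 3}"
      using pos_mod_sign[of 4 n] pos_mod_bound[of 4 n] by auto
    then have "crossed (m + 2 * (n mod 4))" using m by auto
    moreover have "i = m + 2 * (n mod 4) + 8 * (n div 4)"
      using n mult_div_mod_eq[of 4 n] by linarith
    ultimately show ?thesis using crossed_period by simp
  qed
  have "\<not> crossed 0"
  proof
    assume c: "crossed 0"
    have "(cmod (y 0))\<^sup>2 \<le> (cmod (y (0 + 1)))\<^sup>2" using assms by (intro power_mono) auto
    then show False using crossed_square(2,3)[OF c] alpha by linarith
  qed
  then have "odd m" using parity[of 0] by auto
  then have "crossed i" if "odd i" for i using that parity[of i] by simp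
  then show "crossed 1" "crossed 3" "crossed 5" "crossed 7" by simp_all
qed

text \<open>
  With \<open>u\<close> the direction of \<open>y 0\<close>, three successive quarter turns reach \<open>y 2\<close>, \<open>y 4\<close> and \<open>y 6\<close> with
  errors \<open>37 \<alpha>\<close>, \<open>67 \<alpha>\<close> and \<open>97 \<alpha>\<close>; the odd points are sums of their two neighbors up to another \<open>24 \<alpha>\<close>.
\<close>

lemma near_grid:
  assumes "\<And>i. cmod (y 0) \<le> cmod (y i)"
  obtains u where "cmod u = 1"
    "cmod (y 0 - u) \<le> 200 * \<alpha>" "cmod (y 1 - u * (1 + \<i>)) \<le> 200 * \<alpha>"
    "cmod (y 2 - u * \<i>) \<le> 200 * \<alpha>" "cmod (y 3 - u * (- 1 + \<i>)) \<le> 200 * \<alpha>"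
    "cmod (y 4 - u * (- 1)) \<le> 200 * \<alpha>" "cmod (y 5 - u * (- 1 - \<i>)) \<le> 200 * \<alpha>"
    "cmod (y 6 - u * (- \<i>)) \<le> 200 * \<alpha>" "cmod (y 7 - u * (1 - \<i>)) \<le> 200 * \<alpha>"
proof -
  note c = alternately_crossed[OF assms]
  have quarter: "cmod (y (m + 1) - \<i> * y (m - 1)) \<le> 30 * \<alpha>" if "crossed m" for m
  proof (rule near_quarter_turn[OF alpha less_imp_le[OF y_props(4)] _ less_imp_le[OF y_props(4)]])
    have "0 < cross (y (m - 1)) (y (m - 1 + 2))" by (rule cross_next) auto
    moreover have "m - 1 + 2 = m + 1" by simp
    ultimately show "0 < cross (y (m - 1)) (y (m + 1))" by (simp only:)
  qed (use crossed_square[OF that] in auto)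
  have y8: "y 8 = y 0" using y_period[of 0] by simp
  have q: "cmod (y 2 - \<i> * y 0) \<le> 30 * \<alpha>" "cmod (y 4 - \<i> * y 2) \<le> 30 * \<alpha>" "cmod (y 6 - \<i> * y 4) \<le> 30 * \<alpha>"
    using quarter[OF c(1)] quarter[OF c(2)] quarter[OF c(3)] by simp_all
  have mid: "cmod (y 1 - (y 0 + y 2)) \<le> 24 * \<alpha>" "cmod (y 3 - (y 2 + y 4)) \<le> 24 * \<alpha>"
    "cmod (y 5 - (y 4 + y 6)) \<le> 24 * \<alpha>" "cmod (y 7 - (y 6 + y 0)) \<le> 24 * \<alpha>"
    using crossed_square(4)[OF c(1)] crossed_square(4)[OF c(2)] crossed_square(4)[OF c(3)] crossed_square(4)[OF c(4)]
    by (simp_all add: norm_minus_commute y8)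
  define u where "u = y 0 / of_real (cmod (y 0))"
  have u1: "cmod u = 1" unfolding u_def using y_props(2) by (simp add: norm_divide)
  have "cmod (y 0) \<le> 1 + 7 * \<alpha>"
  proof (rule power2_le_imp_le)
    have "(1 + 7 * \<alpha>)\<^sup>2 = 1 + 14 * \<alpha> + 49 * \<alpha>\<^sup>2" by (simp add: power2_eq_square algebra_simps)
    then show "(cmod (y 0))\<^sup>2 \<le> (1 + 7 * \<alpha>)\<^sup>2"
      using crossed_square(1)[OF c(1), unfolded diff_self] alpha zero_le_power2[of \<alpha>] by linarith
  qed (use alpha in simp)
  moreover have "y 0 - u = of_real (cmod (y 0) - 1) * u"
    unfolding u_def using y_props(2)[of 0] by (simp add: field_simps)
  then have "cmod (y 0 - u) = \<bar>cmod (y 0) - 1\<bar>"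
    by (simp only: norm_mult norm_of_real u1 mult_1_right)
  ultimately have k0: "cmod (y 0 - u) \<le> 7 * \<alpha>" using y_props(4)[of 0] alpha by simp
  have step: "cmod (a - \<i> * b) \<le> k + l" if "cmod (a - \<i> * d) \<le> k" "cmod (d - b) \<le> l" for a b d k l
  proof -
    have "a - \<i> * b = (a - \<i> * d) + \<i> * (d - b)" by (simp add: algebra_simps)
    then have "cmod (a - \<i> * b) \<le> cmod (a - \<i> * d) + cmod (\<i> * (d - b))" using norm_triangle_ineq by metis
    then show ?thesis using that by (simp add: norm_mult)
  qed
  have k2: "cmod (y 2 - \<i> * u) \<le> 37 * \<alpha>" using step[OF q(1) k0] by simp
  have k4: "cmod (y 4 - \<i> * (\<i> * u)) \<le> 67 * \<alpha>" using step[OF q(2) k2] by simp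
  have k6: "cmod (y 6 - \<i> * (\<i> * (\<i> * u))) \<le> 97 * \<alpha>" using step[OF q(3) k4] by simp
  have sum3: "cmod (a - (b + d)) \<le> 24 * \<alpha> + k + l"
    if "cmod (a - (b' + d')) \<le> 24 * \<alpha>" "cmod (b' - b) \<le> k" "cmod (d' - d) \<le> l" for a b d b' d' k l
  proof -
    have e: "a - (b + d) = (a - (b' + d')) + ((b' - b) + (d' - d))" by simp
    have "cmod (a - (b + d)) \<le> cmod (a - (b' + d')) + (cmod (b' - b) + cmod (d' - d))"
      unfolding e by (intro norm_triangle_le add_left_mono norm_triangle_ineq)
    then show ?thesis using that by simp
  qed
  note k = sum3[OF mid(1) k0 k2] sum3[OF mid(2) k2 k4] sum3[OF mid(3) k4 k6] sum3[OF mid(4) k6 k0]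
  show thesis
    by (rule that[OF u1]) (use k0 k2 k4 k6 k alpha in \<open>simp_all add: algebra_simps\<close>)
qed

end

section \<open>Labelled configurations\<close>

definition to_complex :: "real^2 \<Rightarrow> complex"
  where "to_complex v = Complex (v $ 1) (v $ 2)"

lemma to_complex_diff: "to_complex (v - w) = to_complex v - to_complex w"
  by (simp add: to_complex_def complex_eq_iff)

lemma norm_to_complex [simp]: "cmod (to_complex v) = norm v"
  by (simp add: to_complex_def cmod_def norm_vec_def L2_set_def sum_2)

lemma to_complex_polar: "to_complex (r *\<^sub>R vector [cos t, sin t]) = rcis r t"
  by (simp add: to_complex_def complex_eq_iff)

text \<open>
  The grid point assigned to the \<open>j\<close>-th neighbor; index \<open>0\<close> stands for the center.
\<close>

definition grid_pt :: "nat \<Rightarrow> real^2"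
  where "grid_pt j = [vector [0, 0], vector [1, 0], vector [1, 1], vector [0, 1], vector [- 1, 1],
    vector [- 1, 0], vector [- 1, - 1], vector [0, - 1], vector [1, - 1]] ! j"

lemma grid_pt_simps:
  "grid_pt 0 = vector [0, 0]" "grid_pt 1 = vector [1, 0]" "grid_pt (Suc 0) = vector [1, 0]" "grid_pt 2 = vector [1, 1]"
  "grid_pt 3 = vector [0, 1]" "grid_pt 4 = vector [- 1, 1]" "grid_pt 5 = vector [- 1, 0]"
  "grid_pt 6 = vector [- 1, - 1]" "grid_pt 7 = vector [0, - 1]" "grid_pt 8 = vector [1, - 1]"
  by (simp_all add: grid_pt_def)

lemma nat_upto_8: "{0..8} = {0, 1, 2, 3, 4, 5, 6, 7, 8 :: nat}"
  by auto

lemma vec2_eq_iff: "v = w \<longleftrightarrow> v $ 1 = w $ 1 \<and> v $ 2 = (w :: real^2) $ 2"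
  by (simp add: vec_eq_iff forall_2)

lemma bij_betw_grid_pt: "bij_betw grid_pt {0..8} grid3"
proof (rule bij_betw_imageI)
  show "inj_on grid_pt {0..8}"
    unfolding nat_upto_8 by (simp add: inj_on_def grid_pt_simps vec2_eq_iff)
  have "v \<in> grid_pt ` {0..8}" if "v \<in> grid3" for v
  proof -
    have "v $ 1 \<in> {-1, 0, 1}" "v $ 2 \<in> {-1, 0, 1}" using that by (auto simp: grid3_def)
    then show ?thesis unfolding nat_upto_8 by (auto simp: grid_pt_simps vec2_eq_iff)
  qed
  moreover have "grid_pt j \<in> grid3" if "j \<in> {0..8}" for j
    using that unfolding nat_upto_8 by (auto simp: grid3_def grid_pt_simps forall_2)
  ultimately show "grid_pt ` {0..8} = grid3" by auto
qed

lemma to_complex_inject: "to_complex v = to_complex w \<longleftrightarrow> v = w"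
  by (simp add: to_complex_def vec2_eq_iff)

lemma norm_vec2: "norm (v :: real^2) = sqrt ((v $ 1)\<^sup>2 + (v $ 2)\<^sup>2)"
  by (simp add: norm_vec_def L2_set_def sum_2)

lemma strict_mono_int:
  fixes f :: "int \<Rightarrow> real"
  assumes "\<And>i. f i < f (i + 1)"
  shows "strict_mono f"
proof (rule strict_monoI)
  fix i j :: int
  assume "i < j"
  then show "f i < f j"
  proof (induction j rule: int_gr_induct)
    case base
    show ?case by (rule assms)
  next
    case (step j)
    then show ?case using assms[of j] by simp
  qed
qed

text \<open>
  The condition \<open>interior\<close> says that \<open>p\<close> and each of its neighbors have exactly eight neighbors
  (\<open>card_neighbors\<close>).
\<close>

locale interior_point =
  fixes \<alpha> :: real and \<Xi> :: "'a set" and X :: "'a \<Rightarrow> real^2" and p :: 'a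
  assumes alpha: "0 < \<alpha>" "\<alpha> \<le> 1/1000"
    and fin: "finite \<Xi>" and inj: "inj_on X \<Xi>"
    and separated: "\<And>q q'. q \<in> \<Xi> \<Longrightarrow> q' \<in> \<Xi> \<Longrightarrow> q \<noteq> q' \<Longrightarrow> 1 - \<alpha> < norm (X q - X q')"
    and p_in: "p \<in> \<Xi>"
    and interior: "closed_nbhd \<alpha> \<Xi> X p \<inter> graph_boundary \<alpha> \<Xi> X = {}"
begin

lemma closed_nbhd_eq:
  assumes "q \<in> \<Xi>"
  shows "closed_nbhd \<alpha> \<Xi> X q = insert q {q' \<in> \<Xi>. q' \<noteq> q \<and> norm (X q' - X q) < sqrt 2 + \<alpha>}"
proof -
  have "{q, q'} \<in> edges \<alpha> \<Xi> X \<longleftrightarrow> q' \<noteq> q \<and> norm (X q' - X q) < sqrt 2 + \<alpha>" if "q' \<in> \<Xi>" for q'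
  proof
    assume "{q, q'} \<in> edges \<alpha> \<Xi> X"
    then obtain a b where ab: "{q, q'} = {a, b}" "1 - \<alpha> < norm (X a - X b)" "norm (X a - X b) < sqrt 2 + \<alpha>"
      by (auto simp: edges_def)
    then show "q' \<noteq> q \<and> norm (X q' - X q) < sqrt 2 + \<alpha>"
      using alpha by (auto simp: doubleton_eq_iff norm_minus_commute)
  next
    assume "q' \<noteq> q \<and> norm (X q' - X q) < sqrt 2 + \<alpha>"
    then show "{q, q'} \<in> edges \<alpha> \<Xi> X"
      using separated[OF assms that] assms that by (auto simp: edges_def norm_minus_commute)
  qed
  then show ?thesis using assms by (auto simp: closed_nbhd_def)
qed

lemma card_neighbors:
  assumes "q \<in> closed_nbhd \<alpha> \<Xi> X p"
  shows "card {q' \<in> \<Xi>. q' \<noteq> q \<and> norm (X q' - X q) < sqrt 2 + \<alpha>} = 8"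
proof -
  have q: "q \<in> \<Xi>" using assms p_in by (auto simp: closed_nbhd_eq)
  then have "card (closed_nbhd \<alpha> \<Xi> X q) = 9"
    using assms interior by (auto simp: graph_boundary_def)
  then show ?thesis unfolding closed_nbhd_eq[OF q] using fin by simp
qed

lemma neighbors_eq: "closed_nbhd \<alpha> \<Xi> X p - {p} = {q \<in> \<Xi>. q \<noteq> p \<and> norm (X q - X p) < sqrt 2 + \<alpha>}"
  unfolding closed_nbhd_eq[OF p_in] by auto

definition offset :: "'a \<Rightarrow> complex"
  where "offset q = to_complex (X q - X p)"

lemma offset_diff: "cmod (offset q - offset q') = norm (X q - X q')"
  unfolding offset_def to_complex_diff[symmetric] by simp

lemma cmod_offset: "cmod (offset q) = norm (X q - X p)"
  unfolding offset_def by simp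

lemma offset_inj: "inj_on offset \<Xi>"
proof (rule inj_onI)
  fix q q' assume "q \<in> \<Xi>" "q' \<in> \<Xi>" "offset q = offset q'"
  then show "q = q'" using offset_diff[of q q'] inj by (auto simp: inj_on_def)
qed

lemma offset_center: "offset p = 0"
  using cmod_offset[of p] by simp

text \<open>
  The polar angles of a counterclockwise labelling span less than one turn, so adding \<open>2 \<pi>\<close> per
  period extends them to an increasing sequence.
\<close>

lemma octet_of_labelling:
  assumes lab: "nbr_labelling \<alpha> \<Xi> X p P"
  obtains \<theta> where "octet \<alpha> (offset ` \<Xi>) (\<lambda>i. offset (P (nat (i mod 8) + 1))) \<theta>"
proof -
  obtain r \<Theta> where r: "\<And>j. j \<in> {1..8} \<Longrightarrow> r j > 0 \<and> X (P j) - X p = r j *\<^sub>R vector [cos (\<Theta> j), sin (\<Theta> j)]"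
    and mono: "strict_mono_on {1..8} \<Theta>" and turn: "\<Theta> 8 < \<Theta> 1 + 2 * pi"
    using lab unfolding nbr_labelling_def counterclockwise_def by blast
  have bij: "bij_betw P {1..8} {q \<in> \<Xi>. q \<noteq> p \<and> norm (X q - X p) < sqrt 2 + \<alpha>}"
    using lab unfolding nbr_labelling_def neighbors_eq by simp
  \<comment> \<open>the labels \<open>1, \<dots>, 8\<close> correspond to the residues \<open>0, \<dots>, 7\<close>\<close>
  define ix where "ix i = nat (i mod 8) + 1" for i :: int
  have ix: "ix i \<in> {1..8}" for i
    using pos_mod_bound[of 8 i] pos_mod_sign[of 8 i] by (auto simp: ix_def)
  have ix_onto: "\<exists>i. k = ix i" if "k \<in> {1..8}" for k
    using that by (intro exI[of _ "int k - 1"]) (auto simp: ix_def nat_diff_distrib)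
  have ix8: "ix (i + 8) = ix i" for i by (simp add: ix_def)
  define \<theta> where "\<theta> i = \<Theta> (ix i) + 2 * pi * of_int (i div 8)" for i
  have nb: "P (ix i) \<in> \<Xi>" "P (ix i) \<noteq> p" "norm (X (P (ix i)) - X p) < sqrt 2 + \<alpha>" for i
    using bij_betwE[OF bij] ix[of i] by auto
  have "octet \<alpha> (offset ` \<Xi>) (\<lambda>i. offset (P (ix i))) \<theta>"
  proof
    show "0 < \<alpha>" "\<alpha> \<le> 1/1000" by (rule alpha)+
    show "1 - \<alpha> < cmod (x - z)" if "x \<in> offset ` \<Xi>" "z \<in> offset ` \<Xi>" "x \<noteq> z" for x z
    proof -
      obtain q q' where "x = offset q" "z = offset q'" "q \<in> \<Xi>" "q' \<in> \<Xi>" using \<open>x \<in> _\<close> \<open>z \<in> _\<close> by auto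
      then show ?thesis using separated[of q q'] \<open>x \<noteq> z\<close> by (auto simp: offset_diff)
    qed
    show "0 \<in> offset ` \<Xi>" using p_in offset_center by (metis imageI)
    have "{z \<in> offset ` \<Xi>. z \<noteq> 0 \<and> cmod z < sqrt 2 + \<alpha>} = offset ` {q \<in> \<Xi>. q \<noteq> p \<and> norm (X q - X p) < sqrt 2 + \<alpha>}"
      using inj_onD[OF offset_inj] p_in by (auto simp: cmod_offset simp flip: offset_center)
    also have "\<dots> = offset ` P ` {1..8}" using bij by (simp add: bij_betw_def)
    also have "\<dots> = range (\<lambda>i. offset (P (ix i)))" using ix ix_onto by fast
    finally show "{z \<in> offset ` \<Xi>. z \<noteq> 0 \<and> cmod z < sqrt 2 + \<alpha>} = range (\<lambda>i. offset (P (ix i)))" .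
    fix i
    show "offset (P (ix (i + 8))) = offset (P (ix i))" by (simp add: ix8)
    show "\<theta> (i + 8) = \<theta> i + 2 * pi" by (simp add: \<theta>_def ix8 algebra_simps)
    have e: "offset (P (ix i)) = rcis (r (ix i)) (\<Theta> (ix i))"
      unfolding offset_def using r[OF ix] by (simp add: to_complex_polar)
    have "rcis (r (ix i)) (\<theta> i) = rcis (r (ix i)) (\<Theta> (ix i))"
      unfolding \<theta>_def by (simp add: complex_eq_iff cos_add sin_add sin_int_2pin cos_int_2pin)
    then show "offset (P (ix i)) = rcis (cmod (offset (P (ix i)))) (\<theta> i)"
      unfolding e using r[OF ix[of i]] by simp
    show "strict_mono \<theta>"
    proof (rule strict_mono_int)
      fix i :: int
      have "((i + 1) mod 8 = i mod 8 + 1 \<and> (i + 1) div 8 = i div 8)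
          \<or> (i mod 8 = 7 \<and> (i + 1) mod 8 = 0 \<and> (i + 1) div 8 = i div 8 + 1)"
        by presburger
      then consider "(i + 1) mod 8 = i mod 8 + 1" "(i + 1) div 8 = i div 8"
        | "i mod 8 = 7" "(i + 1) mod 8 = 0" "(i + 1) div 8 = i div 8 + 1" by blast
      then show "\<theta> i < \<theta> (i + 1)"
      proof cases
        case 1
        then have "ix (i + 1) = ix i + 1" by (simp add: ix_def nat_add_distrib)
        then have "\<Theta> (ix i) < \<Theta> (ix (i + 1))" using ix[of i] ix[of "i + 1"] by (intro strict_mono_onD[OF mono]) auto
        then show ?thesis using 1 by (simp add: \<theta>_def)
      next
        case 2
        then have "ix i = 8" "ix (i + 1) = 1" by (simp_all add: ix_def)
        then show ?thesis using 2 turn by (simp add: \<theta>_def algebra_simps)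
      qed
    qed
    have "{z \<in> offset ` \<Xi>. z \<noteq> offset (P (ix i)) \<and> cmod (z - offset (P (ix i))) < sqrt 2 + \<alpha>}
        = offset ` {q \<in> \<Xi>. q \<noteq> P (ix i) \<and> norm (X q - X (P (ix i))) < sqrt 2 + \<alpha>}"
      using inj_onD[OF offset_inj] nb(1) by (auto simp: offset_diff)
    moreover have "P (ix i) \<in> closed_nbhd \<alpha> \<Xi> X p" using nb by (simp add: closed_nbhd_eq[OF p_in])
    then have "card {q \<in> \<Xi>. q \<noteq> P (ix i) \<and> norm (X q - X (P (ix i))) < sqrt 2 + \<alpha>} = 8" by (rule card_neighbors)
    ultimately show "card {z \<in> offset ` \<Xi>. z \<noteq> offset (P (ix i)) \<and> cmod (z - offset (P (ix i))) < sqrt 2 + \<alpha>} = 8"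
      using inj_on_subset[OF offset_inj] by (simp add: card_image)
  qed
  then show thesis using that by (simp add: ix_def)
qed

lemma first_is_closest:
  assumes "nbr_labelling \<alpha> \<Xi> X p P"
  shows "cmod (offset (P 1)) \<le> cmod (offset (P (nat (i mod 8) + 1)))"
proof -
  have "nat (i mod 8) + 1 \<in> {1..8}"
    using pos_mod_bound[of 8 i] pos_mod_sign[of 8 i] by auto
  then have "Min ((\<lambda>j. norm (X (P j) - X p)) ` {1..8}) \<le> norm (X (P (nat (i mod 8) + 1)) - X p)"
    by (intro Min_le) auto
  then show ?thesis using assms by (simp add: cmod_offset nbr_labelling_def)
qed

text \<open>
  Multiplication by the unit number \<open>u\<close> of \<open>near_grid\<close> is an isometry, so two errors of \<open>200 \<alpha>\<close> add up. Overwriting \<open>P\<close> at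
  \<open>0\<close> by \<open>p\<close> treats the center and the neighbors alike.
\<close>

lemma labelling_near_grid:
  assumes lab: "nbr_labelling \<alpha> \<Xi> X p P" and j: "j \<in> {0..8}" and k: "k \<in> {0..8}"
  shows "\<bar>norm (X ((P(0 := p)) j) - X ((P(0 := p)) k)) - norm (grid_pt j - grid_pt k)\<bar> \<le> 400 * \<alpha>"
proof -
  define y where "y = (\<lambda>i::int. offset (P (nat (i mod 8) + 1)))"
  obtain \<theta> where "octet \<alpha> (offset ` \<Xi>) y \<theta>"
    using octet_of_labelling[OF lab] unfolding y_def .
  then interpret octet \<alpha> "offset ` \<Xi>" y \<theta> .
  have "cmod (y 0) \<le> cmod (y i)" for i
    using first_is_closest[OF lab] by (simp add: y_def)
  then obtain u where u: "cmod u = 1"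
    "cmod (y 0 - u) \<le> 200 * \<alpha>" "cmod (y 1 - u * (1 + \<i>)) \<le> 200 * \<alpha>"
    "cmod (y 2 - u * \<i>) \<le> 200 * \<alpha>" "cmod (y 3 - u * (- 1 + \<i>)) \<le> 200 * \<alpha>"
    "cmod (y 4 - u * (- 1)) \<le> 200 * \<alpha>" "cmod (y 5 - u * (- 1 - \<i>)) \<le> 200 * \<alpha>"
    "cmod (y 6 - u * (- \<i>)) \<le> 200 * \<alpha>" "cmod (y 7 - u * (1 - \<i>)) \<le> 200 * \<alpha>"
    by (rule near_grid)
  have yv: "y 0 = offset (P 1)" "y 1 = offset (P 2)" "y 2 = offset (P 3)" "y 3 = offset (P 4)" "y 4 = offset (P 5)"
    "y 5 = offset (P 6)" "y 6 = offset (P 7)" "y 7 = offset (P 8)"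
    by (simp_all add: y_def eval_nat_numeral)
  have g: "to_complex (grid_pt 1) = 1" "to_complex (grid_pt 2) = 1 + \<i>" "to_complex (grid_pt 3) = \<i>"
    "to_complex (grid_pt 4) = - 1 + \<i>" "to_complex (grid_pt 5) = - 1" "to_complex (grid_pt 6) = - 1 - \<i>"
    "to_complex (grid_pt 7) = - \<i>" "to_complex (grid_pt 8) = 1 - \<i>" "to_complex (grid_pt 0) = 0"
    by (simp_all add: to_complex_def grid_pt_simps complex_eq_iff)
  have near: "cmod (offset ((P(0 := p)) i) - u * to_complex (grid_pt i)) \<le> 200 * \<alpha>" if "i \<in> {0..8}" for i
  proof -
    have "i = 0 \<or> i = 1 \<or> i = 2 \<or> i = 3 \<or> i = 4 \<or> i = 5 \<or> i = 6 \<or> i = 7 \<or> i = 8" using that by auto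
    then show ?thesis
      using u(2-) alpha unfolding yv by (elim disjE) (simp_all add: g[simplified] offset_center)
  qed
  define e where "e i = offset ((P(0 := p)) i) - u * to_complex (grid_pt i)" for i
  have "offset ((P(0 := p)) j) - offset ((P(0 := p)) k) - u * to_complex (grid_pt j - grid_pt k) = e j - e k"
    unfolding e_def to_complex_diff by (simp add: algebra_simps)
  then have "\<bar>cmod (offset ((P(0 := p)) j) - offset ((P(0 := p)) k)) - cmod (u * to_complex (grid_pt j - grid_pt k))\<bar> \<le> cmod (e j - e k)"
    using norm_triangle_ineq3 by metis
  also have "\<dots> \<le> cmod (e j) + cmod (e k)" by (rule norm_triangle_ineq4)
  also have "\<dots> \<le> 400 * \<alpha>" using near[OF j] near[OF k] by (simp add: e_def)
  finally show ?thesis by (simp add: offset_diff norm_mult u(1))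
qed

text \<open>
  The neighbors are sorted by their argument relative to a closest one, which comes first with argument \<open>0\<close>;
  distinct neighbors have distinct arguments by \<open>direction_separation\<close>.
\<close>

lemma labelling_exists: "\<exists>P. nbr_labelling \<alpha> \<Xi> X p P"
proof -
  define N where "N = {q \<in> \<Xi>. q \<noteq> p \<and> norm (X q - X p) < sqrt 2 + \<alpha>}"
  have N8: "card N = 8" unfolding N_def by (rule card_neighbors) (simp add: closed_nbhd_def)
  have finN: "finite N" and neN: "N \<noteq> {}" using N8 by (auto intro: card_ge_0_finite)
  obtain q where q: "q \<in> N" "\<And>q'. q' \<in> N \<Longrightarrow> norm (X q - X p) \<le> norm (X q' - X p)"
    using arg_min_if_finite[OF finN neN, of "\<lambda>q. norm (X q - X p)"] by (metis linorder_le_less_linear)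
  define b where "b = Arg2pi (offset q)"
  define t where "t = (\<lambda>q'. Arg2pi (offset q' * cis (- b)))"
  have offset_pos: "cmod (offset q') > 0" if "q' \<in> N" for q'
    using that separated[of q' p] p_in alpha by (auto simp: N_def cmod_offset)
  have tp: "offset q' = rcis (cmod (offset q')) (b + t q')" for q'
    unfolding t_def by (rule rcis_Arg2pi)
  have tb: "0 \<le> t q'" "t q' < 2 * pi" for q'
    unfolding t_def using Arg2pi by auto
  have "offset q * cis (- b) = of_real (cmod (offset q))"
  proof -
    have "offset q = rcis (cmod (offset q)) (0 + b)" using rcis_Arg2pi[of "offset q" 0] by (simp add: b_def)
    then have "offset q * cis (- b) = rcis (cmod (offset q)) b * cis (- b)" by simp
    then show ?thesis by (simp add: rcis_def mult.assoc cis_mult)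
  qed
  then have tq: "t q = 0" unfolding t_def by (simp add: Arg2pi_of_real)
  have "sqrt 2 \<le> 14143/10000" by (rule real_le_lsqrt) (simp_all add: power2_eq_square)
  then have bnd: "999/1000 \<le> cmod (offset q')" "cmod (offset q') \<le> 14153/10000" if "q' \<in> N" for q'
    using that separated[of q' p] p_in alpha by (auto simp: N_def cmod_offset)
  have tinj: "inj_on t N"
  proof (rule inj_onI, rule ccontr)
    fix x z assume xz: "x \<in> N" "z \<in> N" "t x = t z" "x \<noteq> z"
    have "999/1000 \<le> cmod (offset x - offset z)"
      using separated[of x z] xz alpha by (auto simp: N_def offset_diff)
    then have "715/1000 \<le> (b + t z) - (b + t x)"
      by (subst (asm) tp[of x], subst (asm) tp[of z], intro direction_separation[OF bnd[OF xz(1)] bnd[OF xz(2)]]) (use xz in auto)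
    then show False using xz by simp
  qed
  define xs where "xs = sorted_list_of_set (t ` N)"
  have xs: "set xs = t ` N" "length xs = 8" "sorted_wrt (<) xs"
    unfolding xs_def using finN N8 tinj by (simp_all add: card_image)
  have x0: "xs ! 0 = 0"
  proof -
    have "0 \<in> set xs" using xs q(1) tq by (metis imageI)
    then obtain k where k: "k < 8" "xs ! k = 0" using xs by (metis in_set_conv_nth)
    have "xs ! 0 \<in> t ` N" unfolding xs(1)[symmetric] by (rule nth_mem) (simp add: xs)
    then have "0 \<le> xs ! 0" using tb by auto
    moreover have "k \<noteq> 0 \<Longrightarrow> xs ! 0 < xs ! k" using sorted_wrt_nth_less[OF xs(3), of 0 k] k xs by simp
    ultimately show ?thesis using k by (cases "k = 0") auto
  qed
  define P where "P j = (if j = 9 then q else inv_into N t (xs ! (j - 1)))" for j :: nat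
  have xsN: "xs ! (j - 1) \<in> t ` N" if "j \<in> {1..8}" for j
    unfolding xs(1)[symmetric] using that xs by (intro nth_mem) auto
  have tP: "t (P j) = xs ! (j - 1)" "P j \<in> N" if "j \<in> {1..8}" for j
    using that f_inv_into_f[OF xsN[OF that]] inv_into_into[OF xsN[OF that]] by (auto simp: P_def)
  have P1: "P 1 = q"
    unfolding P_def using x0 tq inv_into_f_f[OF tinj q(1)] by simp
  have sm: "xs ! (i - 1) < xs ! (j - 1)" if "i \<in> {1..8}" "j \<in> {1..8}" "i < j" for i j
    using that xs by (intro sorted_wrt_nth_less[OF xs(3)]) auto
  have injP: "inj_on P {1..8}"
  proof (rule inj_onI)
    fix i j assume ij: "i \<in> {1..8}" "j \<in> {1..8}" "P i = P j"
    then have "xs ! (i - 1) = xs ! (j - 1)" using tP by metis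
    then show "i = j" using sm[OF ij(1,2)] sm[OF ij(2,1)] by (cases i j rule: linorder_cases) auto
  qed
  have "P ` {1..8} = N"
    by (rule card_subset_eq[OF finN]) (use tP injP N8 in \<open>auto simp: card_image\<close>)
  then have bij: "bij_betw P {1..8} (closed_nbhd \<alpha> \<Xi> X p - {p})"
    unfolding neighbors_eq N_def[symmetric] using injP by (simp add: bij_betw_def)
  have "counterclockwise 8 (X p) (\<lambda>j. X (P j))"
    unfolding counterclockwise_def
  proof (intro exI conjI ballI)
    fix j :: nat assume j: "j \<in> {1..8}"
    show "0 < cmod (offset (P j))" using offset_pos tP[OF j] by simp
    have "offset (P j) = to_complex (cmod (offset (P j)) *\<^sub>R vector [cos (b + t (P j)), sin (b + t (P j))])"
      unfolding to_complex_polar by (rule tp)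
    then show "X (P j) - X p = cmod (offset (P j)) *\<^sub>R vector [cos (b + t (P j)), sin (b + t (P j))]"
      by (simp add: offset_def to_complex_inject)
  next
    show "strict_mono_on {1..8} (\<lambda>j. b + t (P j))"
      by (rule strict_mono_onI) (use sm tP in auto)
    show "b + t (P 8) < b + t (P 1) + 2 * pi" using tb(2)[of "P 8"] P1 tq by simp
  qed
  moreover have "norm (X (P 1) - X p) = Min ((\<lambda>j. norm (X (P j) - X p)) ` {1..8})"
    by (rule Min_eqI[symmetric]) (use tP q P1 in auto)
  moreover have "P 9 = P 1" using P1 by (simp add: P_def)
  ultimately show ?thesis using bij unfolding nbr_labelling_def by blast
qed

lemma labelling_bij:
  assumes "nbr_labelling \<alpha> \<Xi> X p P"
  shows "bij_betw (P(0 := p)) {0..8} (closed_nbhd \<alpha> \<Xi> X p)"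
proof -
  have "bij_betw (P(0 := p)) {1..8} (closed_nbhd \<alpha> \<Xi> X p - {p})"
    using assms by (subst bij_betw_cong[of _ _ P]) (auto simp: nbr_labelling_def)
  then have "bij_betw (P(0 := p)) ({1..8} \<union> {0}) ((closed_nbhd \<alpha> \<Xi> X p - {p}) \<union> {p})"
    by (rule bij_betw_combine) (auto simp: bij_betw_def)
  moreover have "{1..8} \<union> {0} = {0..8 :: nat}" by auto
  moreover have "(closed_nbhd \<alpha> \<Xi> X p - {p}) \<union> {p} = closed_nbhd \<alpha> \<Xi> X p" by (auto simp: closed_nbhd_def)
  ultimately show ?thesis by simp
qed

definition chart :: "(nat \<Rightarrow> 'a) \<Rightarrow> 'a \<Rightarrow> real^2"
  where "chart P q = grid_pt (inv_into {0..8} (P(0 := p)) q)"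

lemma chart_label:
  assumes "nbr_labelling \<alpha> \<Xi> X p P" "j \<in> {0..8}"
  shows "chart P ((P(0 := p)) j) = grid_pt j"
  unfolding chart_def
  using inv_into_f_f[OF bij_betw_imp_inj_on[OF labelling_bij[OF assms(1)]] assms(2)] by (rule arg_cong)

lemma chart_bij:
  assumes "nbr_labelling \<alpha> \<Xi> X p P"
  shows "bij_betw (chart P) (closed_nbhd \<alpha> \<Xi> X p) grid3"
  using bij_betw_trans[OF bij_betw_inv_into[OF labelling_bij[OF assms]] bij_betw_grid_pt]
  by (simp add: chart_def[abs_def] comp_def)

text \<open>
  The lengths are those of the grid up to \<open>400 \<alpha>\<close>. The upper bound \<open>sqrt 2 + \<alpha>\<close> in the last claim is
  sharper than that: it holds because the indices \<open>1, 3, 5, 7\<close> of the octagon are crossed, so that these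
  diagonals are edges of the graph.
\<close>

lemma edge_lengths:
  assumes lab: "nbr_labelling \<alpha> \<Xi> X p P"
  shows "\<forall>j\<in>{1..7}. 1 - \<alpha> \<le> norm (X (P (j + 1)) - X (P j)) \<and>
              \<bar>norm (X (P (j + 1)) - X (P j)) - 1\<bar> \<le> 400 * \<alpha>" (is ?sides)
    and "\<forall>j\<in>{0..3}. 1 - \<alpha> \<le> norm (X (P (2 * j + 1)) - X p) \<and>
              \<bar>norm (X (P (2 * j + 1)) - X p) - 1\<bar> \<le> 400 * \<alpha>" (is ?spokes)
    and "\<forall>j\<in>{1..4}. \<bar>norm (X (P (2 * j)) - X p) - sqrt 2\<bar> \<le> 400 * \<alpha>" (is ?diags)
    and "\<forall>j\<in>{1..4}. sqrt 2 - 400 * \<alpha> \<le> norm (X (P (2 * j - 1)) - X (P (2 * j + 1))) \<and>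
              norm (X (P (2 * j - 1)) - X (P (2 * j + 1))) \<le> sqrt 2 + \<alpha>" (is ?cross)
proof -
  have bij: "bij_betw P {1..8} (closed_nbhd \<alpha> \<Xi> X p - {p})" and P9: "P 9 = P 1"
    using lab by (auto simp: nbr_labelling_def)
  have nb: "P j \<in> \<Xi>" "P j \<noteq> p" if "j \<in> {1..8}" for j
    using bij_betwE[OF bij] that by (auto simp: closed_nbhd_eq[OF p_in])
  have near: "\<bar>norm (X (P j) - X (P k)) - norm (grid_pt j - grid_pt k)\<bar> \<le> 400 * \<alpha>"
    if "j \<in> {1..8}" "k \<in> {1..8}" for j k
    using labelling_near_grid[OF lab, of j k] that by simp
  have near0: "\<bar>norm (X (P j) - X p) - norm (grid_pt j)\<bar> \<le> 400 * \<alpha>" if "j \<in> {1..8}" for j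
  proof -
    have "grid_pt 0 = 0" by (simp add: grid_pt_simps vec2_eq_iff)
    then show ?thesis using labelling_near_grid[OF lab, of j 0] that by simp
  qed
  have low: "1 - \<alpha> \<le> norm (X (P j) - X (P k))" if "j \<in> {1..8}" "k \<in> {1..8}" "j \<noteq> k" for j k
  proof -
    have "P j \<noteq> P k" using bij that by (auto simp: bij_betw_def inj_on_def)
    then show ?thesis using separated nb that by (auto intro: less_imp_le)
  qed
  have up_to: "{1..7} = {1, 2, 3, 4, 5, 6, 7 :: nat}" "{0..3} = {0, 1, 2, 3 :: nat}" "{1..4} = {1, 2, 3, 4 :: nat}"
    by auto
  show ?sides
  proof
    fix j :: nat assume j: "j \<in> {1..7}"
    have "norm (grid_pt (j + 1) - grid_pt j) = 1"
      using j unfolding up_to by (auto simp: norm_vec2 grid_pt_def)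
    then show "1 - \<alpha> \<le> norm (X (P (j + 1)) - X (P j)) \<and> \<bar>norm (X (P (j + 1)) - X (P j)) - 1\<bar> \<le> 400 * \<alpha>"
      using near[of "j + 1" j] low[of "j + 1" j] j by auto
  qed
  show ?spokes
  proof
    fix j :: nat assume j: "j \<in> {0..3}"
    have "norm (grid_pt (2 * j + 1)) = 1"
      using j unfolding up_to by (auto simp: norm_vec2 grid_pt_def)
    then show "1 - \<alpha> \<le> norm (X (P (2 * j + 1)) - X p) \<and> \<bar>norm (X (P (2 * j + 1)) - X p) - 1\<bar> \<le> 400 * \<alpha>"
      using near0[of "2 * j + 1"] separated[of "P (2 * j + 1)" p] nb[of "2 * j + 1"] p_in j by auto
  qed
  show ?diags
  proof
    fix j :: nat assume j: "j \<in> {1..4}"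
    have "norm (grid_pt (2 * j)) = sqrt 2"
      using j unfolding up_to by (auto simp: norm_vec2 grid_pt_def)
    then show "\<bar>norm (X (P (2 * j)) - X p) - sqrt 2\<bar> \<le> 400 * \<alpha>"
      using near0[of "2 * j"] j by auto
  qed
  define y where "y = (\<lambda>i::int. offset (P (nat (i mod 8) + 1)))"
  obtain \<theta> where "octet \<alpha> (offset ` \<Xi>) y \<theta>"
    using octet_of_labelling[OF lab] unfolding y_def .
  then interpret octet \<alpha> "offset ` \<Xi>" y \<theta> .
  have "cmod (y 0) \<le> cmod (y i)" for i
    using first_is_closest[OF lab] by (simp add: y_def)
  then have "crossed 1" "crossed 3" "crossed 5" "crossed 7" by (rule alternately_crossed)+
  then have "cmod (y 2 - y 0) < sqrt 2 + \<alpha>" "cmod (y 4 - y 2) < sqrt 2 + \<alpha>"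
    "cmod (y 6 - y 4) < sqrt 2 + \<alpha>" "cmod (y 8 - y 6) < sqrt 2 + \<alpha>"
    by (simp_all add: crossed_def)
  then have "norm (X (P 1) - X (P 3)) < sqrt 2 + \<alpha>" "norm (X (P 3) - X (P 5)) < sqrt 2 + \<alpha>"
    "norm (X (P 5) - X (P 7)) < sqrt 2 + \<alpha>" "norm (X (P 7) - X (P 1)) < sqrt 2 + \<alpha>"
    by (simp_all add: y_def offset_diff norm_minus_commute eval_nat_numeral)
  moreover have "sqrt 2 - 400 * \<alpha> \<le> norm (X (P 1) - X (P 3))" "sqrt 2 - 400 * \<alpha> \<le> norm (X (P 3) - X (P 5))"
    "sqrt 2 - 400 * \<alpha> \<le> norm (X (P 5) - X (P 7))" "sqrt 2 - 400 * \<alpha> \<le> norm (X (P 7) - X (P 1))"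
    using near[of 1 3] near[of 3 5] near[of 5 7] near[of 7 1]
    by (simp_all add: norm_vec2 grid_pt_simps abs_le_iff)
  ultimately show ?cross unfolding up_to using P9 by (simp add: less_imp_le)
qed

text \<open>
  An additive error \<open>400 \<alpha>\<close> is a relative error of at most \<open>500 \<alpha>\<close> because distinct points are at
  distance at least \<open>0.999\<close>.
\<close>

lemma almost_isometric_grid:
  "almost_isometric (500 * \<alpha>) (X ` closed_nbhd \<alpha> \<Xi> X p) grid3"
proof -
  let ?C = "closed_nbhd \<alpha> \<Xi> X p"
  obtain P where lab: "nbr_labelling \<alpha> \<Xi> X p P" using labelling_exists by blast
  have C: "?C \<subseteq> \<Xi>" using closed_nbhd_eq[OF p_in] p_in by auto
  have injC: "inj_on X ?C" using inj C by (rule inj_on_subset)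
  define f where "f = chart P \<circ> inv_into ?C X"
  have "bij_betw f (X ` ?C) grid3"
    unfolding f_def using injC
    by (intro bij_betw_trans[OF bij_betw_inv_into chart_bij[OF lab]]) (simp add: bij_betw_def)
  moreover have "(1 - 500 * \<alpha>) * dist x z \<le> dist (f x) (f z) \<and> dist (f x) (f z) \<le> (1 + 500 * \<alpha>) * dist x z"
    if xz: "x \<in> X ` ?C" "z \<in> X ` ?C" for x z
  proof (cases "x = z")
    case False
    obtain j k where jk: "j \<in> {0..8}" "k \<in> {0..8}" "x = X ((P(0 := p)) j)" "z = X ((P(0 := p)) k)"
      using xz unfolding bij_betw_imp_surj_on[OF labelling_bij[OF lab], symmetric] image_image
      by (elim imageE) simp
    have m: "(P(0 := p)) j \<in> ?C" "(P(0 := p)) k \<in> ?C"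
      using bij_betwE[OF labelling_bij[OF lab]] jk by blast+
    have fx: "f x = grid_pt j" "f z = grid_pt k"
      unfolding f_def jk(3,4) comp_def inv_into_f_f[OF injC m(1)] inv_into_f_f[OF injC m(2)]
      using chart_label[OF lab] jk by blast+
    have "(P(0 := p)) j \<noteq> (P(0 := p)) k" using False jk(3,4) by metis
    then have "1 - \<alpha> < dist x z"
      unfolding jk(3,4) dist_norm using m C by (intro separated) auto
    then have "999/1000 \<le> dist x z" using alpha by simp
    then have "400 * \<alpha> \<le> 500 * \<alpha> * dist x z"
      using mult_left_mono[of "4/5" "dist x z" "500 * \<alpha>"] alpha by simp
    moreover have "\<bar>dist x z - dist (f x) (f z)\<bar> \<le> 400 * \<alpha>"
      using labelling_near_grid[OF lab jk(1,2)] unfolding fx unfolding jk(3,4) dist_norm .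
    ultimately show ?thesis by (simp add: algebra_simps abs_le_iff)
  qed simp
  ultimately show ?thesis unfolding almost_isometric_def by blast
qed

end

section \<open>The local structure theorem\<close>

lemma linear_modulus_linear: "0 \<le> c \<Longrightarrow> linear_modulus a (\<lambda>t. c * t)"
proof -
  assume c: "0 \<le> c"
  have "\<forall>\<^sub>F t in at_right 0. ereal (c * t / t) \<le> ereal c"
    using eventually_at_right_less[of "0::real"] by eventually_elim simp
  then have "Limsup (at_right 0) (\<lambda>t. ereal (c * t / t)) \<le> ereal c" by (rule Limsup_bounded)
  then show ?thesis unfolding linear_modulus_def using c
    by (auto intro!: continuous_intros intro: le_less_trans)
qed

theorem lemma3p5:
  "\<exists>\<alpha>0::real. 0 < \<alpha>0 \<and> \<alpha>0 < 1 \<and>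
    (\<exists>\<omega>1 \<omega>2 \<omega>3 \<omega>4 C3.
      linear_modulus \<alpha>0 \<omega>1 \<and> linear_modulus \<alpha>0 \<omega>2 \<and>
      linear_modulus \<alpha>0 \<omega>3 \<and> linear_modulus \<alpha>0 \<omega>4 \<and>
      1 \<le> C3 \<and> C3 < 1 / \<alpha>0 \<and>
      (\<forall>\<alpha>. 0 < \<alpha> \<and> \<alpha> < \<alpha>0 \<longrightarrow>
        (\<forall>(\<Xi> :: 'a set) (X :: 'a \<Rightarrow> real^2) p.
          finite \<Xi> \<and> inj_on X \<Xi> \<and>
          (\<forall>q\<in>\<Xi>. \<forall>q'\<in>\<Xi>. q \<noteq> q' \<longrightarrow> norm (X q - X q') > 1 - \<alpha>) \<and>
          p \<in> \<Xi> \<and> closed_nbhd \<alpha> \<Xi> X p \<inter> graph_boundary \<alpha> \<Xi> X = {} \<longrightarrow>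
          (\<exists>P. nbr_labelling \<alpha> \<Xi> X p P) \<and>
          (\<forall>P. nbr_labelling \<alpha> \<Xi> X p P \<longrightarrow>
            (\<exists>\<phi>. bij_betw \<phi> (closed_nbhd \<alpha> \<Xi> X p) grid3 \<and>
              \<phi> p = vector [0, 0] \<and>
              \<phi> (P 1) = vector [1, 0] \<and> \<phi> (P 2) = vector [1, 1] \<and>
              \<phi> (P 3) = vector [0, 1] \<and> \<phi> (P 4) = vector [-1, 1] \<and>
              \<phi> (P 5) = vector [-1, 0] \<and> \<phi> (P 6) = vector [-1, -1] \<and>
              \<phi> (P 7) = vector [0, -1] \<and> \<phi> (P 8) = vector [1, -1]) \<and>
            (\<forall>j\<in>{1..7}.
              1 - \<alpha> \<le> norm (X (P (j + 1)) - X (P j)) \<and>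
              \<bar>norm (X (P (j + 1)) - X (P j)) - 1\<bar> \<le> \<omega>1 \<alpha>) \<and>
            (\<forall>j\<in>{0..3}.
              1 - \<alpha> \<le> norm (X (P (2 * j + 1)) - X p) \<and>
              \<bar>norm (X (P (2 * j + 1)) - X p) - 1\<bar> \<le> \<omega>2 \<alpha>) \<and>
            (\<forall>j\<in>{1..4}.
              \<bar>norm (X (P (2 * j)) - X p) - sqrt 2\<bar> \<le> \<omega>3 \<alpha>) \<and>
            (\<forall>j\<in>{1..4}.
              sqrt 2 - \<omega>4 \<alpha> \<le> norm (X (P (2 * j - 1)) - X (P (2 * j + 1))) \<and>
              norm (X (P (2 * j - 1)) - X (P (2 * j + 1))) \<le> sqrt 2 + \<alpha>)) \<and>
          almost_isometric (C3 * \<alpha>) (X ` closed_nbhd \<alpha> \<Xi> X p) grid3)))"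
proof -
  have claim: "(\<exists>P. nbr_labelling \<alpha> \<Xi> X p P) \<and>
          (\<forall>P. nbr_labelling \<alpha> \<Xi> X p P \<longrightarrow>
            (\<exists>\<phi>. bij_betw \<phi> (closed_nbhd \<alpha> \<Xi> X p) grid3 \<and>
              \<phi> p = vector [0, 0] \<and>
              \<phi> (P 1) = vector [1, 0] \<and> \<phi> (P 2) = vector [1, 1] \<and>
              \<phi> (P 3) = vector [0, 1] \<and> \<phi> (P 4) = vector [-1, 1] \<and>
              \<phi> (P 5) = vector [-1, 0] \<and> \<phi> (P 6) = vector [-1, -1] \<and>
              \<phi> (P 7) = vector [0, -1] \<and> \<phi> (P 8) = vector [1, -1]) \<and>
            (\<forall>j\<in>{1..7}.
              1 - \<alpha> \<le> norm (X (P (j + 1)) - X (P j)) \<and>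
              \<bar>norm (X (P (j + 1)) - X (P j)) - 1\<bar> \<le> 400 * \<alpha>) \<and>
            (\<forall>j\<in>{0..3}.
              1 - \<alpha> \<le> norm (X (P (2 * j + 1)) - X p) \<and>
              \<bar>norm (X (P (2 * j + 1)) - X p) - 1\<bar> \<le> 400 * \<alpha>) \<and>
            (\<forall>j\<in>{1..4}.
              \<bar>norm (X (P (2 * j)) - X p) - sqrt 2\<bar> \<le> 400 * \<alpha>) \<and>
            (\<forall>j\<in>{1..4}.
              sqrt 2 - 400 * \<alpha> \<le> norm (X (P (2 * j - 1)) - X (P (2 * j + 1))) \<and>
              norm (X (P (2 * j - 1)) - X (P (2 * j + 1))) \<le> sqrt 2 + \<alpha>)) \<and>
          almost_isometric (500 * \<alpha>) (X ` closed_nbhd \<alpha> \<Xi> X p) grid3"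
    if \<alpha>: "0 < \<alpha> \<and> \<alpha> < 1/1000"
      and hyp: "finite \<Xi> \<and> inj_on X \<Xi> \<and>
          (\<forall>q\<in>\<Xi>. \<forall>q'\<in>\<Xi>. q \<noteq> q' \<longrightarrow> norm (X q - X q') > 1 - \<alpha>) \<and>
          p \<in> \<Xi> \<and> closed_nbhd \<alpha> \<Xi> X p \<inter> graph_boundary \<alpha> \<Xi> X = {}"
    for \<alpha> and \<Xi> :: "'a set" and X :: "'a \<Rightarrow> real^2" and p
  proof -
    interpret interior_point \<alpha> \<Xi> X p
      by unfold_locales (use \<alpha> hyp in auto)
    have "\<exists>\<phi>. bij_betw \<phi> (closed_nbhd \<alpha> \<Xi> X p) grid3 \<and>
              \<phi> p = vector [0, 0] \<and>
              \<phi> (P 1) = vector [1, 0] \<and> \<phi> (P 2) = vector [1, 1] \<and>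
              \<phi> (P 3) = vector [0, 1] \<and> \<phi> (P 4) = vector [-1, 1] \<and>
              \<phi> (P 5) = vector [-1, 0] \<and> \<phi> (P 6) = vector [-1, -1] \<and>
              \<phi> (P 7) = vector [0, -1] \<and> \<phi> (P 8) = vector [1, -1]"
      if lab: "nbr_labelling \<alpha> \<Xi> X p P" for P
    proof (intro exI[of _ "chart P"] conjI)
      show "bij_betw (chart P) (closed_nbhd \<alpha> \<Xi> X p) grid3" by (rule chart_bij[OF lab])
    qed (use chart_label[OF lab, of 0] chart_label[OF lab, of 1] chart_label[OF lab, of 2]
          chart_label[OF lab, of 3] chart_label[OF lab, of 4] chart_label[OF lab, of 5]
          chart_label[OF lab, of 6] chart_label[OF lab, of 7] chart_label[OF lab, of 8]
        in \<open>simp_all add: grid_pt_simps\<close>)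
    then show ?thesis
      by (intro conjI allI impI labelling_exists almost_isometric_grid edge_lengths)
  qed
  have lin: "linear_modulus (1/1000) (\<lambda>t. 400 * t)" by (rule linear_modulus_linear) simp
  show ?thesis
  proof (rule exI[of _ "1/1000"], intro conjI, goal_cases)
    case 3
    show ?case
      by (rule exI[of _ "\<lambda>t. 400 * t"], rule exI[of _ "\<lambda>t. 400 * t"], rule exI[of _ "\<lambda>t. 400 * t"],
          rule exI[of _ "\<lambda>t. 400 * t"], rule exI[of _ 500], intro conjI lin, simp, simp)
        (intro allI impI claim)
  qed simp_all
qed

end
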